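(* There exist universal constants $c_0,c_1,C>0$, $s\in(0,1)$ and $\psi\in(0,1)$ such that if $m>c_0n$ and $A\in\mathbb{R}^{m\times n}$ is a random matrix whose entries are i.i.d. standard Gaussians $N(0,1)$, then with probability at least $1-C\exp(-c_1m)$, $$\|(|Ax|^2-|Ay|^2)_T\|_1\le\psi\,\|(|Ax|^2-|Ay|^2)_{T^c}\|_1\quad\text{for all }x,y\in\mathbb{R}^n\text{ and all }T\subseteq[m]\text{ with }|T|\le sm.$$ Consequently, $A$ satisfies the $2$-Absolute Range Property (of order $sm$ for $\psi$) with high probability for $m$ sufficiently large.
   Context: For a vector $z\in\mathbb{R}^m$, $|z|$ and $z^2$ denote the vectors of entrywise absolute values and squares; $[m]=\{1,\dots,m\}$; for $T\subseteq[m]$, $z_T\in\mathbb{R}^m$ is the vector with $i$-th entry $z_i$ if $i\in T$ and $0$ otherwise; $T^c=[m]\setminus T$. For $p\in\{1,2\}$, a matrix $A\in\mathbb{R}^{m\times n}$ satisfies the $p$-Absolute Range Property of order $L$ for $\psi\in(0,1)$ if $\|(|Ax|^p-|Ay|^p)_T\|_1\le\psi\|(|Ax|^p-|Ay|^p)_{T^c}\|_1$ for all $x,y\in\mathbb{R}^n$ and all $T\subseteq[m]$ with $|T|\le L$. *)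

theory Defs
  imports "HOL-Probability.Probability" "Jordan_Normal_Form.Matrix"
begin

definition l1_norm_vec :: "real vec \<Rightarrow> real" where
  "l1_norm_vec z = (\<Sum>i<dim_vec z. \<bar>vec_index z i\<bar>)"

definition vec_on :: "real vec \<Rightarrow> nat set \<Rightarrow> real vec" where
  "vec_on z T = vec (dim_vec z) (\<lambda>i. if i \<in> T then vec_index z i else 0)"

definition abs_pow_vec :: "nat \<Rightarrow> real vec \<Rightarrow> real vec" where
  "abs_pow_vec p z = map_vec (\<lambda>t. \<bar>t\<bar> ^ p) z"

text \<open>The order \<open>L\<close> is a real number because it is used as \<open>s * m\<close>, which need not be an integer.
  Coordinates are numbered \<open>0, \<dots>, m - 1\<close>.\<close>

definition absolute_range_property :: "nat \<Rightarrow> real \<Rightarrow> real \<Rightarrow> real mat \<Rightarrow> bool" where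
  "absolute_range_property p L \<psi> A \<longleftrightarrow>
     p \<in> {1, 2} \<and> 0 < \<psi> \<and> \<psi> < 1 \<and>
     (\<forall>x\<in>carrier_vec (dim_col A). \<forall>y\<in>carrier_vec (dim_col A).
        \<forall>T\<subseteq>{..<dim_row A}. real (card T) \<le> L \<longrightarrow>
          l1_norm_vec (vec_on (abs_pow_vec p (A *\<^sub>v x) - abs_pow_vec p (A *\<^sub>v y)) T)
          \<le> \<psi> * l1_norm_vec (vec_on (abs_pow_vec p (A *\<^sub>v x) - abs_pow_vec p (A *\<^sub>v y))
                                 ({..<dim_row A} - T)))"

text \<open>The joint law of the \<open>m * n\<close> i.i.d. standard Gaussian entries. An outcome \<open>\<omega>\<close> assigns to each
  position \<open>(i, j)\<close> the entry \<open>\<omega> (i, j)\<close>, so the random matrix is \<open>mat m n \<omega>\<close>. Using the law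
  rather than an arbitrary underlying probability space keeps the constants of the theorem
  independent of the space (and of its type); the lemma below shows that any random matrix with such
  entries has this law.\<close>

definition gaussian_entries :: "nat \<Rightarrow> nat \<Rightarrow> (nat \<times> nat \<Rightarrow> real) measure" where
  "gaussian_entries m n = (\<Pi>\<^sub>M k\<in>{..<m} \<times> {..<n}. density lborel std_normal_density)"

lemma distr_iid_eq_gaussian_entries:
  assumes "prob_space M" and "0 < m" and "0 < n"
    and indep: "prob_space.indep_vars M (\<lambda>_. borel) X ({..<m} \<times> {..<n})"
    and gauss: "\<And>k. k \<in> {..<m} \<times> {..<n} \<Longrightarrow> distributed M lborel (X k) std_normal_density"
  shows "distr M (\<Pi>\<^sub>M k\<in>{..<m} \<times> {..<n}. borel) (\<lambda>\<omega>. \<lambda>k\<in>{..<m} \<times> {..<n}. X k \<omega>)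
           = gaussian_entries m n"
proof -
  interpret prob_space M by fact
  have X: "random_variable borel (X k)" if "k \<in> {..<m} \<times> {..<n}" for k
    using distributed_measurable[OF gauss[OF that]] by simp
  have "distr M borel (X k) = density lborel std_normal_density" if "k \<in> {..<m} \<times> {..<n}" for k
    using distributed_distr_eq_density[OF gauss[OF that]] by (simp cong: distr_cong)
  then have *: "(\<Pi>\<^sub>M k\<in>{..<m} \<times> {..<n}. distr M borel (X k)) = gaussian_entries m n"
    unfolding gaussian_entries_def by (intro PiM_cong) auto
  show ?thesis
    using indep_vars_iff_distr_eq_PiM'[where I = "{..<m} \<times> {..<n}" and M' = "\<lambda>_. borel" and X = X]
      X indep * \<open>0 < m\<close> \<open>0 < n\<close> by (simp add: lessThan_empty_iff)
qed

end

theory Submission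
  imports Defs
begin

text \<open>Entrywise \<open>\<bar>A x\<bar>\<^sup>2 - \<bar>A y\<bar>\<^sup>2 = A u * A v\<close> with \<open>u = x - y\<close> and \<open>v = x + y\<close>, so the claim concerns sums of
  products \<open>\<bar>(A u)\<^sub>i (A v)\<^sub>i\<bar>\<close> for unit vectors. It follows from two facts about a single unit vector
  \<open>u\<close>, holding simultaneously for all \<open>u\<close> with high probability: at most a fifth of the coordinates
  of \<open>A u\<close> are below \<open>\<tau>\<close>, and any \<open>s m\<close> of them have square sum at most \<open>\<tau>\<^sup>2 m / 4\<close>. The first gives
  at least \<open>m / 2\<close> coordinates outside \<open>T\<close> at which both factors are at least \<open>\<tau>\<close>, the second bounds
  the sum over \<open>T\<close>. For fixed \<open>u\<close> both are Chernoff bounds, for the number of coordinates below \<open>2 \<tau>\<close>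
  and for the truncated sum of \<open>max 0 ((A u)\<^sub>i\<^sup>2 - K)\<close>, which avoids a union over the sets \<open>T\<close>;
  they extend to all \<open>u\<close> through a net of the sphere of cardinality exponential in \<open>n\<close>, absorbed by
  taking \<open>c0\<close> large.\<close>

section \<open>Nets of the Euclidean sphere\<close>

text \<open>The value stays below 3 for every \<open>B\<close>, which is where the base
  \<open>3\<close> of the lattice count comes from.\<close>

lemma sum_half_power_abs:
  "(\<Sum>k = - int B..int B. (1/2::real) ^ nat \<bar>k\<bar>) = 3 - 2 * (1/2) ^ B"
proof (induction B)
  case (Suc B)
  have "{- int (Suc B)..int (Suc B)} = insert (- int (Suc B)) (insert (int (Suc B)) {- int B..int B})"
    by auto
  then show ?case using Suc by (simp add: nat_add_distrib)
qed simp

lemma abs_int_le_square: "\<bar>k\<bar> \<le> k\<^sup>2" for k :: int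
  using self_le_power[of "\<bar>k\<bar>" 2] by (cases "k = 0") auto

lemma exp_neg_square_le: "exp (- (of_int k)\<^sup>2 :: real) \<le> (1/2) ^ nat \<bar>k\<bar>"
proof -
  have "real (nat \<bar>k\<bar>) \<le> real_of_int (k\<^sup>2)"
    using abs_int_le_square[of k] by linarith
  then have "exp (- (of_int k)\<^sup>2 :: real) \<le> exp (- real (nat \<bar>k\<bar>))" by simp
  also have "\<dots> = exp (-1) ^ nat \<bar>k\<bar>" by (simp add: exp_of_nat_mult[symmetric])
  also have "exp (-1 :: real) \<le> 1/2"
    using exp_ge_add_one_self[of 1] by (simp add: exp_minus field_simps)
  then have "exp (-1 :: real) ^ nat \<bar>k\<bar> \<le> (1/2) ^ nat \<bar>k\<bar>" by (intro power_mono) auto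
  finally show ?thesis .
qed

text \<open>Chernoff-style counting of lattice points in a ball: the indicator of
  \<open>\<Sum>j<n. (k j)\<^sup>2 \<le> r * n\<close> is at most \<open>exp (r * n) * (\<Prod>j<n. exp (- (k j)\<^sup>2))\<close>.\<close>

lemma card_lattice_ball_le:
  fixes r :: real and B n :: nat
  defines "P \<equiv> {..<n} \<rightarrow>\<^sub>E {- int B..int B}"
  shows "real (card {k \<in> P. (\<Sum>j<n. (of_int (k j))\<^sup>2) \<le> r * n}) \<le> (3 * exp r) ^ n"
proof -
  have fin: "finite P" unfolding P_def by (intro finite_PiE) auto
  have "real (card {k \<in> P. (\<Sum>j<n. (of_int (k j))\<^sup>2) \<le> r * n})
      = (\<Sum>k\<in>{k \<in> P. (\<Sum>j<n. (of_int (k j))\<^sup>2) \<le> r * n}. 1)" by simp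
  also have "\<dots> \<le> (\<Sum>k\<in>{k \<in> P. (\<Sum>j<n. (of_int (k j))\<^sup>2) \<le> r * n}.
      exp (r * n - (\<Sum>j<n. (of_int (k j))\<^sup>2)))"
    by (intro sum_mono) auto
  also have "\<dots> \<le> (\<Sum>k\<in>P. exp (r * n - (\<Sum>j<n. (of_int (k j))\<^sup>2)))"
    using fin by (intro sum_mono2) auto
  also have "\<dots> = exp (r * n) * (\<Sum>k\<in>P. \<Prod>j<n. exp (- (of_int (k j))\<^sup>2))"
    by (simp add: sum_distrib_left exp_diff exp_sum exp_minus prod_inversef[symmetric] divide_inverse o_def)
  also have "(\<Sum>k\<in>P. \<Prod>j<n. exp (- (of_int (k j))\<^sup>2)) =
      (\<Prod>j<n. \<Sum>k\<in>{- int B..int B}. exp (- (of_int k :: real)\<^sup>2))"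
    unfolding P_def by (subst prod_sum_PiE) auto
  also have "\<dots> = (\<Sum>k\<in>{- int B..int B}. exp (- (of_int k :: real)\<^sup>2)) ^ n" by simp
  also have "\<dots> \<le> 3 ^ n"
  proof (intro power_mono)
    have "(\<Sum>k\<in>{- int B..int B}. exp (- (of_int k :: real)\<^sup>2)) \<le> (\<Sum>k\<in>{- int B..int B}. (1/2) ^ nat \<bar>k\<bar>)"
      by (intro sum_mono exp_neg_square_le)
    also have "\<dots> \<le> 3" unfolding sum_half_power_abs by simp
    finally show "(\<Sum>k\<in>{- int B..int B}. exp (- (of_int k :: real)\<^sup>2)) \<le> 3" .
  qed (auto intro: sum_nonneg)
  finally show ?thesis
    by (simp add: power_mult_distrib exp_of_nat2_mult mult.commute)
qed

text \<open>Rounding goes towards zero and not to the nearest integer, so that a rounded vector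
  never leaves the ball that contains the original one.\<close>

lemma truncate_exists:
  fixes x :: real
  obtains k :: int where "\<bar>of_int k\<bar> \<le> \<bar>x\<bar>" "\<bar>x - of_int k\<bar> \<le> 1"
proof (cases "x \<ge> 0")
  case True
  then show ?thesis by (intro that[of "\<lfloor>x\<rfloor>"]; simp add: abs_if; linarith)
next
  case False
  then have "\<lceil>x\<rceil> \<le> 0" by linarith
  then have "\<bar>real_of_int \<lceil>x\<rceil>\<bar> \<le> \<bar>x\<bar>" "\<bar>x - real_of_int \<lceil>x\<rceil>\<bar> \<le> 1"
    using False by linarith+
  then show ?thesis by (rule that)
qed

text \<open>The net consists of the points in the unit ball of a lattice of spacing
  \<open>h = \<epsilon> / sqrt n\<close>. Rounding costs at most \<open>h\<close> per coordinate,
  hence \<open>\<epsilon>\<close> in Euclidean norm. Divided by \<open>h\<close>, the ball has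
  squared radius \<open>n / \<epsilon>\<^sup>2\<close>, so the lattice count applies with
  \<open>r = 1 / \<epsilon>\<^sup>2\<close>.\<close>

lemma ball_net_exists:
  fixes \<epsilon> :: real and n :: nat
  assumes "\<epsilon> > 0"
  obtains N :: "(nat \<Rightarrow> real) set" where
    "finite N" "real (card N) \<le> (3 * exp (1 / \<epsilon>\<^sup>2)) ^ n"
    "\<And>u. L2_set u {..<n} \<le> 1 \<Longrightarrow>
       \<exists>w\<in>N. L2_set w {..<n} \<le> 1 \<and> L2_set (\<lambda>j. u j - w j) {..<n} \<le> \<epsilon>"
proof -
  \<comment> \<open>\<open>B\<close> only serves to make the set of lattice points finite: an
    integer with \<open>k\<^sup>2 \<le> n / \<epsilon>\<^sup>2\<close> satisfies
    \<open>\<bar>k\<bar> \<le> k\<^sup>2 \<le> B\<close>.\<close>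
  define B where "B = nat \<lceil>n / \<epsilon>\<^sup>2\<rceil>"
  define P where "P = {..<n} \<rightarrow>\<^sub>E {- int B..int B}"
  define G where "G = {k \<in> P. (\<Sum>j<n. (real_of_int (k j))\<^sup>2) \<le> 1 / \<epsilon>\<^sup>2 * n}"
  define h where "h = \<epsilon> / sqrt n"
  define N where "N = (\<lambda>k j. h * real_of_int (k j)) ` G"
  have "finite P" unfolding P_def by (intro finite_PiE) auto
  then have finG: "finite G" unfolding G_def by simp
  have card: "real (card N) \<le> (3 * exp (1 / \<epsilon>\<^sup>2)) ^ n"
    using card_lattice_ball_le[of n B "1 / \<epsilon>\<^sup>2"] card_image_le[OF finG, of "\<lambda>k j. h * real_of_int (k j)"]
    unfolding N_def G_def P_def by linarith
  have net: "\<exists>w\<in>N. L2_set w {..<n} \<le> 1 \<and> L2_set (\<lambda>j. u j - w j) {..<n} \<le> \<epsilon>"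
    if u: "L2_set u {..<n} \<le> 1" for u
  proof (cases "n = 0")
    case True
    \<comment> \<open>For \<open>n = 0\<close> the set \<open>P\<close> contains only the everywhere
      \<open>undefined\<close> function, and every norm over \<open>{..<n}\<close> is zero.\<close>
    have "(\<lambda>_. undefined) \<in> G" using True by (simp add: G_def P_def)
    then show ?thesis using True assms by (auto simp: N_def)
  next
    case False
    then have h: "h > 0" using assms by (simp add: h_def)
    have hn: "h\<^sup>2 * n = \<epsilon>\<^sup>2" using False by (simp add: h_def power_divide)
    have "\<exists>k::int. \<bar>real_of_int k\<bar> \<le> \<bar>x\<bar> \<and> \<bar>x - of_int k\<bar> \<le> 1" for x :: real
      using truncate_exists[of x] by metis
    then obtain f :: "real \<Rightarrow> int" where
      f: "\<And>x. \<bar>real_of_int (f x)\<bar> \<le> \<bar>x\<bar>" "\<And>x. \<bar>x - of_int (f x)\<bar> \<le> 1" by metis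
    define k where "k = (\<lambda>j\<in>{..<n}. f (u j / h))"
    have kj: "k j = f (u j / h)" if "j < n" for j using that by (simp add: k_def)
    have sq: "(real_of_int (k j))\<^sup>2 \<le> (u j)\<^sup>2 / h\<^sup>2" if "j < n" for j
      using f(1)[of "u j / h"] unfolding kj[OF that]
      by (metis abs_le_square_iff power_divide)
    have u2: "(\<Sum>j<n. (u j)\<^sup>2) \<le> 1" using u by (simp add: L2_set_def)
    have "(\<Sum>j<n. (real_of_int (k j))\<^sup>2) \<le> (\<Sum>j<n. (u j)\<^sup>2 / h\<^sup>2)" by (intro sum_mono sq) auto
    also have "\<dots> \<le> 1 / h\<^sup>2" using u2 h by (simp add: sum_divide_distrib[symmetric] divide_right_mono)
    also have "\<dots> = n / \<epsilon>\<^sup>2" using hn False h by (simp add: hn[symmetric])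
    finally have S: "(\<Sum>j<n. (real_of_int (k j))\<^sup>2) \<le> n / \<epsilon>\<^sup>2" .
    have "k \<in> P" unfolding P_def
    proof (rule PiE_I)
      fix j assume j: "j \<in> {..<n}"
      have "(real_of_int (k j))\<^sup>2 \<le> (\<Sum>j<n. (real_of_int (k j))\<^sup>2)"
        using member_le_sum[of j "{..<n}" "\<lambda>j. (real_of_int (k j))\<^sup>2"] j by auto
      with S have "real_of_int ((k j)\<^sup>2) \<le> n / \<epsilon>\<^sup>2" by simp
      then have "(k j)\<^sup>2 \<le> int B" unfolding B_def by linarith
      then show "k j \<in> {- int B..int B}" using abs_int_le_square[of "k j"] by auto
    qed (simp add: k_def)
    with S have kG: "k \<in> G" by (simp add: G_def)
    define w where "w = (\<lambda>j. h * real_of_int (k j))"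
    have "L2_set w {..<n} \<le> L2_set u {..<n}" unfolding L2_set_def
    proof (intro real_sqrt_le_mono sum_mono)
      fix j assume "j \<in> {..<n}"
      then show "(w j)\<^sup>2 \<le> (u j)\<^sup>2" using sq[of j] h by (simp add: w_def power_mult_distrib field_simps)
    qed
    moreover have "L2_set (\<lambda>j. u j - w j) {..<n} \<le> \<epsilon>"
    proof -
      have "(\<Sum>j<n. (u j - w j)\<^sup>2) \<le> (\<Sum>j<n. h\<^sup>2)"
      proof (rule sum_mono)
        fix j assume j: "j \<in> {..<n}"
        have "u j - w j = h * (u j / h - of_int (f (u j / h)))"
          using h j by (simp add: w_def kj algebra_simps)
        moreover have "(u j / h - of_int (f (u j / h)))\<^sup>2 \<le> 1"
          using f(2)[of "u j / h"] by (simp add: abs_square_le_1)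
        ultimately show "(u j - w j)\<^sup>2 \<le> h\<^sup>2"
          by (simp add: power_mult_distrib mult_left_le)
      qed
      also have "\<dots> = \<epsilon>\<^sup>2" using hn by (simp add: mult.commute)
      finally show ?thesis unfolding L2_set_def using assms real_le_lsqrt by auto
    qed
    ultimately show ?thesis using u kG by (intro bexI[of _ w]) (auto simp: N_def w_def)
  qed
  show thesis using that[OF _ card net] finG by (auto simp: N_def)
qed

lemma L2_set_scale: "L2_set (\<lambda>j. c * f j) A = \<bar>c\<bar> * L2_set f A"
  by (simp add: L2_set_def power_mult_distrib sum_distrib_left[symmetric] real_sqrt_mult)

lemma L2_set_power2: "(L2_set f A)\<^sup>2 = (\<Sum>i\<in>A. (f i)\<^sup>2)"
  by (simp add: L2_set_def sum_nonneg)

lemma L2_set_normalize: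
  assumes "L2_set u A \<noteq> 0"
  shows "L2_set (\<lambda>j. (1 / L2_set u A) * u j) A = 1"
  using assms by (subst L2_set_scale) (simp add: L2_set_nonneg)

text \<open>Rescaling the points of a net of the unit ball to the unit sphere at most doubles the mesh.\<close>

lemma sphere_net_exists:
  fixes \<epsilon> :: real and n :: nat
  assumes \<epsilon>: "0 < \<epsilon>" "\<epsilon> < 1"
  obtains N :: "(nat \<Rightarrow> real) set" where
    "finite N" "real (card N) \<le> (3 * exp (4 / \<epsilon>\<^sup>2)) ^ n"
    "\<And>w. w \<in> N \<Longrightarrow> L2_set w {..<n} = 1"
    "\<And>u. L2_set u {..<n} = 1 \<Longrightarrow> \<exists>w\<in>N. L2_set (\<lambda>j. u j - w j) {..<n} \<le> \<epsilon>"
proof -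
  obtain B :: "(nat \<Rightarrow> real) set" where B: "finite B" "real (card B) \<le> (3 * exp (1 / (\<epsilon> / 2)\<^sup>2)) ^ n"
    "\<And>u. L2_set u {..<n} \<le> 1 \<Longrightarrow>
       \<exists>w\<in>B. L2_set w {..<n} \<le> 1 \<and> L2_set (\<lambda>j. u j - w j) {..<n} \<le> \<epsilon> / 2"
    using ball_net_exists[of "\<epsilon> / 2" n] \<epsilon> by auto
  \<comment> \<open>Points of norm zero cannot be normalized. Discarding them is harmless, since a
    point within \<open>\<epsilon> / 2\<close> of a unit vector has norm at least
    \<open>1 - \<epsilon> / 2\<close>.\<close>
  define C where "C = {w \<in> B. L2_set w {..<n} \<noteq> 0}"
  define N where "N = (\<lambda>w j. (1 / L2_set w {..<n}) * w j) ` C"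
  have "finite C" "card C \<le> card B" using B(1) by (auto simp: C_def intro: card_mono)
  then have "finite N" "card N \<le> card B"
    using card_image_le[of C] unfolding N_def by (auto intro: order_trans)
  moreover have "1 / (\<epsilon> / 2)\<^sup>2 = 4 / \<epsilon>\<^sup>2" by (simp add: power_divide)
  ultimately have card: "finite N" "real (card N) \<le> (3 * exp (4 / \<epsilon>\<^sup>2)) ^ n"
    using B(2) by auto
  have unit: "L2_set w {..<n} = 1" if "w \<in> N" for w
    using that L2_set_normalize unfolding N_def C_def by auto
  have net: "\<exists>w\<in>N. L2_set (\<lambda>j. u j - w j) {..<n} \<le> \<epsilon>" if u: "L2_set u {..<n} = 1" for u
  proof -
    obtain w where w: "w \<in> B" "L2_set w {..<n} \<le> 1" "L2_set (\<lambda>j. u j - w j) {..<n} \<le> \<epsilon> / 2"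
      using B(3)[of u] u by auto
    let ?r = "L2_set w {..<n}"
    have "1 \<le> L2_set (\<lambda>j. u j - w j) {..<n} + ?r"
      using L2_set_triangle_ineq[of "\<lambda>j. u j - w j" w "{..<n}"] u by simp
    with w(3) have r: "1 - \<epsilon> / 2 \<le> ?r" by linarith
    then have pos: "?r > 0" using \<epsilon> by linarith
    \<comment> \<open>Normalizing moves \<open>w\<close> radially by \<open>1 - ?r\<close>, which is
      at most \<open>\<epsilon> / 2\<close>.\<close>
    have "L2_set (\<lambda>j. w j - (1 / ?r) * w j) {..<n} = L2_set (\<lambda>j. (1 - 1 / ?r) * w j) {..<n}"
      by (simp add: algebra_simps)
    also have "\<dots> = \<bar>(1 - 1 / ?r) * ?r\<bar>" by (simp add: L2_set_scale abs_mult L2_set_nonneg)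
    also have "(1 - 1 / ?r) * ?r = ?r - 1" using pos by (simp add: algebra_simps)
    finally have "L2_set (\<lambda>j. w j - (1 / ?r) * w j) {..<n} \<le> \<epsilon> / 2" using r w(2) by simp
    then have "L2_set (\<lambda>j. u j - (1 / ?r) * w j) {..<n} \<le> \<epsilon>"
      using L2_set_triangle_ineq[of "\<lambda>j. u j - w j" "\<lambda>j. w j - (1 / ?r) * w j" "{..<n}"] w(3) by simp
    then show ?thesis using w(1) pos by (auto simp: N_def C_def)
  qed
  show thesis using that card unit net by blast
qed

section \<open>Gaussian rows\<close>

text \<open>This is the \<open>i\<close>-th coordinate of \<open>A u\<close>. Vectors are functions
  on the naturals that are read only below \<open>n\<close>, so norms are \<open>L2_set\<close> and
  linear combinations need no dimension checks.\<close>

definition row_dot :: "nat \<Rightarrow> (nat \<times> nat \<Rightarrow> real) \<Rightarrow> (nat \<Rightarrow> real) \<Rightarrow> nat \<Rightarrow> real" where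
  "row_dot n \<omega> u i = (\<Sum>j<n. \<omega> (i, j) * u j)"

lemma prob_space_gaussian_entries: "prob_space (gaussian_entries m n)"
  unfolding gaussian_entries_def
  by (intro prob_space_PiM prob_space_normal_density) simp

lemma sets_gaussian_entries [measurable_cong]:
  "sets (gaussian_entries m n) = sets (\<Pi>\<^sub>M k\<in>{..<m} \<times> {..<n}. borel)"
  unfolding gaussian_entries_def by (intro sets_PiM_cong) auto

lemma measurable_row_dot [measurable]:
  assumes "i < m"
  shows "(\<lambda>\<omega>. row_dot n \<omega> u i) \<in> borel_measurable (gaussian_entries m n)"
proof -
  have [measurable]: "(\<lambda>\<omega>. \<omega> (i, j)) \<in> borel_measurable (gaussian_entries m n)" if "j < n" for j
  proof -
    have "(i, j) \<in> {..<m} \<times> {..<n}" using assms that by simp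
    then show ?thesis by measurable
  qed
  show ?thesis unfolding row_dot_def by measurable
qed

lemma
  fixes m n :: nat
  defines "M \<equiv> gaussian_entries m n"
  shows indep_gaussian_entries:
      "prob_space.indep_vars M (\<lambda>_. borel) (\<lambda>k \<omega>. \<omega> k) ({..<m} \<times> {..<n})"
    and distr_gaussian_entries:
      "k \<in> {..<m} \<times> {..<n} \<Longrightarrow> distributed M lborel (\<lambda>\<omega>. \<omega> k) std_normal_density"
proof -
  interpret prob_space M unfolding M_def by (rule prob_space_gaussian_entries)
  let ?I = "{..<m} \<times> {..<n}" and ?g = "density lborel (\<lambda>x. ennreal (std_normal_density x))"
  have meas [measurable]: "(\<lambda>\<omega>. \<omega> k) \<in> borel_measurable M" if "k \<in> ?I" for k
    using that unfolding M_def by measurable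
  have distr: "distr M borel (\<lambda>\<omega>. \<omega> k) = ?g" if "k \<in> ?I" for k
  proof -
    have "distr M borel (\<lambda>\<omega>. \<omega> k) = distr M ?g (\<lambda>\<omega>. \<omega> k)"
      by (intro distr_cong) auto
    also have "\<dots> = ?g" unfolding M_def gaussian_entries_def
      using that by (intro distr_PiM_component prob_space_normal_density) auto
    finally show ?thesis .
  qed
  show "distributed M lborel (\<lambda>\<omega>. \<omega> k) std_normal_density" if "k \<in> ?I"
    unfolding distributed_def using distr[OF that] meas[OF that]
    by (auto cong: distr_cong)
  show "indep_vars (\<lambda>_. borel) (\<lambda>k \<omega>. \<omega> k) ?I"
  \<comment> \<open>The criterion for independence by the joint law, used in the second case, is for
    nonempty index sets.\<close>
  proof (cases "?I = {}")
    case True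
    then show ?thesis by (simp only: indep_vars_def indep_sets_def) auto
  next
    case False
    have "distr M (\<Pi>\<^sub>M k\<in>?I. borel) (\<lambda>\<omega>. \<lambda>k\<in>?I. \<omega> k) = distr M M (\<lambda>\<omega>. \<omega>)"
    proof (rule distr_cong)
      show "sets (\<Pi>\<^sub>M k\<in>?I. borel) = sets M" unfolding M_def by (rule sets_gaussian_entries[symmetric])
      fix \<omega> assume "\<omega> \<in> space M"
      then have "\<omega> \<in> extensional ?I"
        unfolding M_def gaussian_entries_def by (auto simp: space_PiM PiE_def)
      then show "(\<lambda>k\<in>?I. \<omega> k) = \<omega>" by (rule extensional_restrict)
    qed simp
    also have "\<dots> = (\<Pi>\<^sub>M k\<in>?I. ?g)" unfolding M_def by (simp add: gaussian_entries_def)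
    also have "\<dots> = (\<Pi>\<^sub>M k\<in>?I. distr M borel (\<lambda>\<omega>. \<omega> k))"
      by (intro PiM_cong) (simp_all add: distr)
    finally show ?thesis
      using False by (subst indep_vars_iff_distr_eq_PiM') auto
  qed
qed

text \<open>Rotation invariance of the Gaussian law: the variances \<open>(u j)\<^sup>2\<close> of
  the independent normal summands add up to 1.\<close>

lemma distributed_row_dot:
  assumes i: "i < m" and u: "L2_set u {..<n} = 1"
  shows "distributed (gaussian_entries m n) lborel (\<lambda>\<omega>. row_dot n \<omega> u i) std_normal_density"
proof -
  define M where "M = gaussian_entries m n"
  interpret prob_space M unfolding M_def by (rule prob_space_gaussian_entries)
  \<comment> \<open>A vanishing coefficient would contribute a constant, which has no density, so
    only nonzero coefficients enter the sum of independent normals.\<close>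
  define J where "J = {j. j < n \<and> u j \<noteq> 0}"
  have u2: "(\<Sum>j<n. (u j)\<^sup>2) = 1" using u by (simp add: L2_set_def)
  have J2: "(\<Sum>j\<in>J. (u j)\<^sup>2) = 1"
    unfolding u2[symmetric] J_def by (intro sum.mono_neutral_left) auto
  \<comment> \<open>Regrouping into singleton blocks passes from the index pairs
    \<open>(i, j)\<close> to the single index \<open>j\<close>.\<close>
  have "indep_vars (\<lambda>j. \<Pi>\<^sub>M k\<in>{(i, j)}. borel) (\<lambda>j \<omega>. restrict (\<lambda>k. \<omega> k) {(i, j)}) J"
    using indep_gaussian_entries[of m n] i
    by (intro indep_vars_restrict) (auto simp: M_def J_def disjoint_family_on_def)
  then have "indep_vars (\<lambda>_. borel) (\<lambda>j \<omega>. u j * restrict (\<lambda>k. \<omega> k) {(i, j)} (i, j)) J"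
    by (rule indep_vars_compose2) auto
  then have ind: "indep_vars (\<lambda>_. borel) (\<lambda>j \<omega>. u j * \<omega> (i, j)) J" by simp
  have dist: "distributed M lborel (\<lambda>\<omega>. u j * \<omega> (i, j)) (normal_density 0 \<bar>u j\<bar>)" if "j \<in> J" for j
    using normal_density_affine[of "\<lambda>\<omega>. \<omega> (i, j)" 0 1 "u j" 0] that i
      distr_gaussian_entries[of "(i, j)" m n] by (auto simp: J_def M_def)
  have "distributed M lborel (\<lambda>\<omega>. \<Sum>j\<in>J. u j * \<omega> (i, j))
      (normal_density (\<Sum>j\<in>J. 0) (sqrt (\<Sum>j\<in>J. \<bar>u j\<bar>\<^sup>2)))"
  proof (intro sum_indep_normal ind dist)
    show "J \<noteq> {}" using J2 by auto
  qed (auto simp: J_def)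
  also have "(\<lambda>\<omega>. \<Sum>j\<in>J. u j * \<omega> (i, j)) = (\<lambda>\<omega>. row_dot n \<omega> u i)"
    unfolding row_dot_def J_def by (intro ext sum.mono_neutral_cong_left) auto
  finally show ?thesis using J2 by (simp add: M_def)
qed

text \<open>Each coordinate depends only on its own row, and the rows are disjoint blocks of
  independent entries.\<close>

lemma indep_row_dot:
  assumes n: "n > 0"
  shows "prob_space.indep_vars (gaussian_entries m n) (\<lambda>_. borel) (\<lambda>i \<omega>. row_dot n \<omega> u i) {..<m}"
proof -
  define M where "M = gaussian_entries m n"
  interpret prob_space M unfolding M_def by (rule prob_space_gaussian_entries)
  define K where "K i = {i} \<times> {..<n}" for i :: nat
  have "indep_vars (\<lambda>i. \<Pi>\<^sub>M k\<in>K i. borel) (\<lambda>i \<omega>. restrict (\<lambda>k. \<omega> k) (K i)) {..<m}"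
    using indep_gaussian_entries[of m n]
    by (intro indep_vars_restrict) (auto simp: M_def K_def disjoint_family_on_def)
  then have "indep_vars (\<lambda>_. borel)
      (\<lambda>i \<omega>. row_dot n (restrict (\<lambda>k. \<omega> k) (K i)) u i) {..<m}"
  proof (rule indep_vars_compose2)
    fix i
    have [measurable]: "(\<lambda>\<omega>. \<omega> (i, j)) \<in> borel_measurable (\<Pi>\<^sub>M k\<in>K i. borel :: real measure)" if "j < n" for j
      using that by (intro measurable_component_singleton) (auto simp: K_def)
    show "(\<lambda>\<omega>. row_dot n \<omega> u i) \<in> borel_measurable (\<Pi>\<^sub>M k\<in>K i. borel)"
      unfolding row_dot_def by measurable (auto simp: K_def)
  qed
  also have "(\<lambda>i \<omega>. row_dot n (restrict (\<lambda>k. \<omega> k) (K i)) u i) = (\<lambda>i \<omega>. row_dot n \<omega> u i)"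
    by (auto simp: row_dot_def K_def intro!: sum.cong)
  finally show ?thesis by (simp add: M_def)
qed

text \<open>Chernoff's method: Markov's inequality for \<open>exp\<close> of the sum, whose
  expectation factors by independence, followed by \<open>1 + \<eta> \<le> exp \<eta>\<close>. The
  exponential parameter is part of \<open>F\<close>, and nonnegative integrals spare all
  integrability conditions.\<close>

lemma prob_sum_row_dot_ge:
  fixes F :: "real \<Rightarrow> real"
  assumes u: "L2_set u {..<n} = 1" and F [measurable]: "F \<in> borel_measurable borel"
    and \<eta>: "0 \<le> \<eta>"
    and mgf: "(\<integral>\<^sup>+x. ennreal (exp (F x)) \<partial>density lborel std_normal_density) \<le> ennreal (1 + \<eta>)"
  shows "measure (gaussian_entries m n)
    {\<omega> \<in> space (gaussian_entries m n). (\<Sum>i<m. F (row_dot n \<omega> u i)) \<ge> t * m} \<le> exp (- (t - \<eta>) * m)"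
proof -
  define M where "M = gaussian_entries m n"
  interpret prob_space M unfolding M_def by (rule prob_space_gaussian_entries)
  have n: "n > 0" using u by (cases n) (auto simp: L2_set_def)
  have meas [measurable]: "(\<lambda>\<omega>. row_dot n \<omega> u i) \<in> borel_measurable M" if "i < m" for i
    unfolding M_def by (rule measurable_row_dot[OF that])
  have E: "(\<integral>\<^sup>+\<omega>. ennreal (exp (F (row_dot n \<omega> u i))) \<partial>M) \<le> ennreal (1 + \<eta>)" if "i < m" for i
  proof -
    have "(\<integral>\<^sup>+\<omega>. ennreal (exp (F (row_dot n \<omega> u i))) \<partial>M)
        = (\<integral>\<^sup>+x. ennreal (exp (F x)) \<partial>distr M lborel (\<lambda>\<omega>. row_dot n \<omega> u i))"
      using that by (subst nn_integral_distr) auto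
    also have "distr M lborel (\<lambda>\<omega>. row_dot n \<omega> u i) = density lborel std_normal_density"
      unfolding M_def by (rule distributed_distr_eq_density[OF distributed_row_dot[OF that u]])
    finally show ?thesis using mgf by simp
  qed
  have ind: "indep_vars (\<lambda>_. borel) (\<lambda>i \<omega>. ennreal (exp (F (row_dot n \<omega> u i)))) {..<m}"
    using indep_row_dot[OF n, of m u] unfolding M_def[symmetric] by (rule indep_vars_compose2) auto
  have "(\<integral>\<^sup>+\<omega>. ennreal (exp (\<Sum>i<m. F (row_dot n \<omega> u i))) \<partial>M)
      = (\<integral>\<^sup>+\<omega>. (\<Prod>i<m. ennreal (exp (F (row_dot n \<omega> u i)))) \<partial>M)"
    by (simp add: exp_sum prod_ennreal)
  also have "\<dots> = (\<Prod>i<m. \<integral>\<^sup>+\<omega>. ennreal (exp (F (row_dot n \<omega> u i))) \<partial>M)"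
    by (intro indep_vars_nn_integral ind) auto
  also have "\<dots> \<le> (\<Prod>i<m. ennreal (1 + \<eta>))" by (intro prod_mono_ennreal) (auto simp: E)
  also have "\<dots> = ennreal ((1 + \<eta>) ^ m)" using \<eta> by (simp add: ennreal_power del: ennreal_plus)
  finally have int: "(\<integral>\<^sup>+\<omega>. ennreal (exp (\<Sum>i<m. F (row_dot n \<omega> u i))) \<partial>M) \<le> ennreal ((1 + \<eta>) ^ m)" .
  let ?c = "ennreal (exp (- (t * m)))"
  have "emeasure M {\<omega> \<in> space M. (\<Sum>i<m. F (row_dot n \<omega> u i)) \<ge> t * m}
      = emeasure M {\<omega> \<in> space M. 1 \<le> ?c * ennreal (exp (\<Sum>i<m. F (row_dot n \<omega> u i)))}"
    by (intro arg_cong[where f = "emeasure M"])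
       (auto simp: ennreal_mult'[symmetric] exp_add[symmetric])
  also have "\<dots> \<le> ?c * (\<integral>\<^sup>+\<omega>. ennreal (exp (\<Sum>i<m. F (row_dot n \<omega> u i))) * indicator (space M) \<omega> \<partial>M)"
    by (intro nn_integral_Markov_inequality) auto
  also have "\<dots> = ?c * (\<integral>\<^sup>+\<omega>. ennreal (exp (\<Sum>i<m. F (row_dot n \<omega> u i))) \<partial>M)"
    by (intro arg_cong2[where f = "(*)"] nn_integral_cong) auto
  also have "\<dots> \<le> ?c * ennreal ((1 + \<eta>) ^ m)" by (intro mult_left_mono int) auto
  also have "\<dots> = ennreal (exp (- (t * m)) * (1 + \<eta>) ^ m)"
    using \<eta> by (simp add: ennreal_mult[symmetric] del: ennreal_plus)
  also have "\<dots> \<le> ennreal (exp (- (t - \<eta>) * m))"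
  proof (rule ennreal_leI)
    have "(1 + \<eta>) ^ m \<le> exp \<eta> ^ m" using \<eta> by (intro power_mono) auto
    then have "(1 + \<eta>) ^ m \<le> exp (\<eta> * m)" by (simp add: exp_of_nat2_mult)
    then have "exp (- (t * m)) * (1 + \<eta>) ^ m \<le> exp (- (t * m)) * exp (\<eta> * m)"
      by (intro mult_left_mono) auto
    then show "exp (- (t * m)) * (1 + \<eta>) ^ m \<le> exp (- (t - \<eta>) * m)"
      by (simp add: exp_add[symmetric] algebra_simps)
  qed
  finally show ?thesis unfolding M_def[symmetric] by (simp add: emeasure_eq_measure)
qed

section \<open>Exponential moments of a standard Gaussian variable\<close>

lemma std_normal_mgf_indicator_le:
  assumes "0 \<le> r" "0 \<le> l"
  shows "(\<integral>\<^sup>+x. ennreal (exp (if \<bar>x\<bar> < r then l else 0)) \<partial>density lborel std_normal_density)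
    \<le> ennreal (1 + 2 * r * exp l)"
proof -
  \<comment> \<open>A density of at most 1 gives the interval \<open>{-r..r}\<close> mass at most
    \<open>2 * r\<close>.\<close>
  have bound: "std_normal_density x \<le> 1" for x
  proof -
    have "std_normal_density x \<le> 1 / sqrt (2 * pi) * 1"
      unfolding std_normal_density_def by (intro mult_left_mono) auto
    also have "\<dots> \<le> 1" using pi_gt3 by (simp add: real_le_rsqrt)
    finally show ?thesis .
  qed
  interpret prob_space "density lborel (\<lambda>x. ennreal (std_normal_density x))"
    by (rule prob_space_normal_density) simp
  have "emeasure (density lborel std_normal_density) {-r..r}
      = (\<integral>\<^sup>+x. ennreal (std_normal_density x) * indicator {-r..r} x \<partial>lborel)"
    by (simp add: emeasure_density)
  also have "\<dots> \<le> (\<integral>\<^sup>+x. indicator {-r..r} x \<partial>lborel)"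
    using bound by (intro nn_integral_mono) (auto simp: indicator_def)
  also have "\<dots> = ennreal (2 * r)" using assms by simp
  finally have measure_le: "emeasure (density lborel std_normal_density) {-r..r} \<le> ennreal (2 * r)" .
  have "(\<integral>\<^sup>+x. ennreal (exp (if \<bar>x\<bar> < r then l else 0)) \<partial>density lborel std_normal_density)
    \<le> (\<integral>\<^sup>+x. 1 + ennreal (exp l) * indicator {-r..r} x \<partial>density lborel std_normal_density)"
    by (intro nn_integral_mono) (auto simp: indicator_def intro: add_increasing)
  also have "\<dots> = 1 + ennreal (exp l) * emeasure (density lborel std_normal_density) {-r..r}"
    using emeasure_space_1 by (simp add: nn_integral_add nn_integral_cmult)
  also have "\<dots> \<le> 1 + ennreal (exp l) * ennreal (2 * r)"
    by (intro add_left_mono mult_left_mono measure_le) auto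
  also have "\<dots> = ennreal (1 + 2 * r * exp l)"
    using assms by (simp add: ennreal_mult[symmetric] ennreal_plus[symmetric] mult_ac
      flip: ennreal_1 del: ennreal_plus)
  finally show ?thesis .
qed

text \<open>The factor \<open>exp (x\<^sup>2 / 4)\<close> turns the standard normal density into
  \<open>sqrt 2\<close> times the density of variance 2.\<close>

lemma nn_integral_std_normal_exp_square:
  "(\<integral>\<^sup>+x. ennreal (exp (x\<^sup>2 / 4)) \<partial>density lborel std_normal_density) = ennreal (sqrt 2)"
proof -
  have "(\<integral>\<^sup>+x. ennreal (exp (x\<^sup>2 / 4)) \<partial>density lborel std_normal_density)
      = (\<integral>\<^sup>+x. ennreal (std_normal_density x) * ennreal (exp (x\<^sup>2 / 4)) \<partial>lborel)"
    by (simp add: nn_integral_density)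
  also have "\<dots> = (\<integral>\<^sup>+x. ennreal (sqrt 2) * ennreal (normal_density 0 (sqrt 2) x) \<partial>lborel)"
  proof (intro nn_integral_cong)
    fix x :: real
    have "std_normal_density x * exp (x\<^sup>2 / 4) = sqrt 2 * normal_density 0 (sqrt 2) x"
      unfolding normal_density_def
      by (simp add: exp_add[symmetric] real_sqrt_mult field_simps)
    then show "ennreal (std_normal_density x) * ennreal (exp (x\<^sup>2 / 4)) =
        ennreal (sqrt 2) * ennreal (normal_density 0 (sqrt 2) x)"
      by (simp add: ennreal_mult'[symmetric])
  qed
  also have "\<dots> = ennreal (sqrt 2) * (\<integral>\<^sup>+x. ennreal (normal_density 0 (sqrt 2) x) \<partial>lborel)"
    by (simp add: nn_integral_cmult)
  also have "(\<integral>\<^sup>+x. ennreal (normal_density 0 (sqrt 2) x) \<partial>lborel) = 1"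
    by (simp add: nn_integral_eq_integral)
  finally show ?thesis by simp
qed

text \<open>By \<open>exp (max 0 y) \<le> 1 + exp y\<close> the moment exceeds 1 only by a term that
  decays exponentially in \<open>K\<close>, so a large truncation level makes the loss in the
  Chernoff bound as small as desired.\<close>

lemma std_normal_mgf_excess_le:
  "(\<integral>\<^sup>+x. ennreal (exp (max 0 (x\<^sup>2 - K) / 4)) \<partial>density lborel std_normal_density)
    \<le> ennreal (1 + 2 * exp (- K / 4))"
proof -
  interpret prob_space "density lborel (\<lambda>x. ennreal (std_normal_density x))"
    by (rule prob_space_normal_density) simp
  have "(\<integral>\<^sup>+x. ennreal (exp (max 0 (x\<^sup>2 - K) / 4)) \<partial>density lborel std_normal_density)
    \<le> (\<integral>\<^sup>+x. 1 + ennreal (exp (- K / 4)) * ennreal (exp (x\<^sup>2 / 4)) \<partial>density lborel std_normal_density)"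
  proof (intro nn_integral_mono)
    fix x :: real
    have "exp (max 0 (x\<^sup>2 - K) / 4) \<le> 1 + exp (- K / 4) * exp (x\<^sup>2 / 4)"
      by (auto simp: max_def exp_add[symmetric] field_simps)
    then show "ennreal (exp (max 0 (x\<^sup>2 - K) / 4)) \<le> 1 + ennreal (exp (- K / 4)) * ennreal (exp (x\<^sup>2 / 4))"
      by (simp add: ennreal_mult[symmetric] ennreal_plus[symmetric] flip: ennreal_1 del: ennreal_plus)
  qed
  also have "\<dots> = 1 + ennreal (exp (- K / 4)) * ennreal (sqrt 2)"
    using emeasure_space_1
    by (simp add: nn_integral_add nn_integral_cmult nn_integral_std_normal_exp_square)
  also have "\<dots> = ennreal (1 + sqrt 2 * exp (- K / 4))"
    by (simp add: ennreal_mult[symmetric] ennreal_plus[symmetric] mult_ac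
      flip: ennreal_1 del: ennreal_plus)
  also have "\<dots> \<le> ennreal (1 + 2 * exp (- K / 4))"
    using real_sqrt_le_mono[of 2 4] by (intro ennreal_leI) (auto intro!: mult_right_mono)
  finally show ?thesis .
qed

section \<open>From the net to all vectors\<close>

lemma row_dot_scale: "row_dot n \<omega> (\<lambda>j. c * u j) = (\<lambda>i. c * row_dot n \<omega> u i)"
  by (simp add: row_dot_def sum_distrib_left mult_ac fun_eq_iff)

lemma row_dot_diff: "row_dot n \<omega> (\<lambda>j. u j - w j) = (\<lambda>i. row_dot n \<omega> u i - row_dot n \<omega> w i)"
  by (simp add: row_dot_def sum_subtractf algebra_simps fun_eq_iff)

text \<open>This makes the supremum that defines the operator norm finite. By Cauchy-Schwarz each
  coordinate is at most the norm of its row.\<close>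

lemma row_dot_bounded: "\<exists>C. \<forall>u. L2_set u {..<n} \<le> 1 \<longrightarrow> L2_set (row_dot n \<omega> u) {..<m} \<le> C"
proof (intro exI allI impI)
  fix u assume u: "L2_set u {..<n} \<le> 1"
  have "\<bar>row_dot n \<omega> u i\<bar> \<le> L2_set (\<lambda>j. \<omega> (i, j)) {..<n}" for i
  proof -
    have "\<bar>row_dot n \<omega> u i\<bar> \<le> (\<Sum>j<n. \<bar>\<omega> (i, j)\<bar> * \<bar>u j\<bar>)"
      unfolding row_dot_def by (rule order_trans[OF sum_abs]) (simp add: abs_mult)
    also have "\<dots> \<le> L2_set (\<lambda>j. \<omega> (i, j)) {..<n} * L2_set u {..<n}" by (rule L2_set_mult_ineq)
    also have "\<dots> \<le> L2_set (\<lambda>j. \<omega> (i, j)) {..<n}" using u by (simp add: mult_left_le L2_set_nonneg)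
    finally show ?thesis .
  qed
  then show "L2_set (row_dot n \<omega> u) {..<m} \<le> (\<Sum>i<m. L2_set (\<lambda>j. \<omega> (i, j)) {..<n})"
    by (intro order_trans[OF L2_set_le_sum_abs] sum_mono)
qed

text \<open>If \<open>S\<close> is the operator norm, approximating a unit vector by the net gives \<open>S \<le> M + \<epsilon> * S\<close>.\<close>

lemma operator_norm_le_net:
  assumes \<epsilon>: "0 < \<epsilon>" "\<epsilon> \<le> 1 / 2"
    and net: "\<And>u. L2_set u {..<n} = 1 \<Longrightarrow> \<exists>w\<in>N. L2_set (\<lambda>j. u j - w j) {..<n} \<le> \<epsilon>"
    and M: "0 \<le> M" "\<And>w. w \<in> N \<Longrightarrow> L2_set (row_dot n \<omega> w) {..<m} \<le> M"
  shows "L2_set (row_dot n \<omega> u) {..<m} \<le> 2 * M * L2_set u {..<n}"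
proof -
  define A where "A u = L2_set (row_dot n \<omega> u) {..<m}" for u
  define S where "S = (SUP u\<in>{u. L2_set u {..<n} \<le> 1}. A u)"
  have bdd: "bdd_above (A ` {u. L2_set u {..<n} \<le> 1})"
    using row_dot_bounded[of n \<omega> m] by (auto simp: A_def bdd_above_def)
  have le_S: "A u \<le> S" if "L2_set u {..<n} \<le> 1" for u
    unfolding S_def using that by (intro cSUP_upper bdd) auto
  have A_scale: "A (\<lambda>j. c * u j) = \<bar>c\<bar> * A u" for c u
    by (simp add: A_def row_dot_scale L2_set_scale)
  have A_nonneg: "0 \<le> A u" for u by (simp add: A_def L2_set_nonneg)
  have S0: "0 \<le> S" using le_S[of "\<lambda>_. 0"] A_nonneg[of "\<lambda>_. 0"] by (simp add: L2_set_def)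
  have unit: "A u \<le> M + \<epsilon> * S" if "L2_set u {..<n} = 1" for u
  proof -
    obtain w where w: "w \<in> N" "L2_set (\<lambda>j. u j - w j) {..<n} \<le> \<epsilon>" using net \<open>L2_set u {..<n} = 1\<close> by blast
    have "A u \<le> A (\<lambda>j. u j - w j) + A w"
      using L2_set_triangle_ineq[of "row_dot n \<omega> (\<lambda>j. u j - w j)" "row_dot n \<omega> w" "{..<m}"]
      by (simp add: A_def row_dot_diff)
    \<comment> \<open>Divided by \<open>\<epsilon>\<close>, the difference lies in the unit ball,
      where \<open>S\<close> is a bound.\<close>
    moreover have "A (\<lambda>j. (1 / \<epsilon>) * (u j - w j)) \<le> S"
      using w(2) \<epsilon> by (intro le_S) (simp only: L2_set_scale, simp)
    then have "A (\<lambda>j. u j - w j) \<le> \<epsilon> * S"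
      using \<epsilon> by (simp only: A_scale) (simp add: field_simps)
    moreover have "A w \<le> M" using M(2)[OF w(1)] by (simp add: A_def)
    ultimately show ?thesis by linarith
  qed
  have gen: "A u \<le> L2_set u {..<n} * (M + \<epsilon> * S)" for u
  proof (cases "L2_set u {..<n} = 0")
    case True
    then have "A u = 0" by (simp add: A_def row_dot_def L2_set_eq_0_iff)
    with True show ?thesis by simp
  next
    case False
    then have pos: "L2_set u {..<n} > 0" using L2_set_nonneg[of u "{..<n}"] by linarith
    then show ?thesis using unit[OF L2_set_normalize[OF False]]
      by (simp only: A_scale) (simp add: field_simps)
  qed
  have "S \<le> M + \<epsilon> * S" 
    unfolding S_def
  proof (rule cSUP_least)
    show "{u. L2_set u {..<n} \<le> 1} \<noteq> {}" by (auto intro!: exI[of _ "\<lambda>_. 0"] simp: L2_set_def)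
    fix u assume "u \<in> {u. L2_set u {..<n} \<le> 1}"
    then have "L2_set u {..<n} * (M + \<epsilon> * S) \<le> 1 * (M + \<epsilon> * S)"
      using M \<epsilon> S0 by (intro mult_right_mono) auto
    with gen[of u] show "A u \<le> M + \<epsilon> * (SUP u\<in>{u. L2_set u {..<n} \<le> 1}. A u)"
      by (simp add: S_def)
  qed
  \<comment> \<open>As \<open>S\<close> is a finite real, half of it can be subtracted:
    \<open>S \<le> M + S / 2\<close> gives \<open>S \<le> 2 * M\<close>.\<close>
  moreover have "\<epsilon> * S \<le> 1 / 2 * S" using \<epsilon> S0 by (intro mult_right_mono) auto
  ultimately have "M + \<epsilon> * S \<le> 2 * M" by linarith
  then have "L2_set u {..<n} * (M + \<epsilon> * S) \<le> L2_set u {..<n} * (2 * M)"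
    by (intro mult_left_mono) (auto simp: L2_set_nonneg)
  with gen[of u] show ?thesis by (simp add: A_def mult_ac)
qed

text \<open>One fixed outcome that is good on the net; everything in this context is deterministic.
  \<open>\<tau>\<close> is the threshold for small coordinates, \<open>K\<close> the truncation
  level and \<open>\<delta>\<close> the allowed mean excess above it. On the net smallness is tested
  at \<open>2 * \<tau>\<close>, to leave room for approximation errors below \<open>\<tau>\<close>.
  The factors 32 and \<open>128 = 4 * 32\<close> keep each error term at most
  \<open>\<tau>\<^sup>2 / 32 * m\<close>.\<close>

locale spread_on_net =
  fixes m n :: nat and \<omega> :: "nat \<times> nat \<Rightarrow> real" and N :: "(nat \<Rightarrow> real) set"
    and \<epsilon> K \<delta> \<tau> s :: real
  assumes pos: "0 < \<epsilon>" "0 < K" "0 < \<delta>" "0 < \<tau>"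
    and \<epsilon>_le: "\<epsilon> \<le> 1 / 2"
    and mesh: "128 * \<epsilon>\<^sup>2 * (K + \<delta>) \<le> \<tau>\<^sup>2"
    and \<delta>_le: "32 * \<delta> \<le> \<tau>\<^sup>2"
    and s_le: "s \<le> 1 / 10" "32 * (s * K) \<le> \<tau>\<^sup>2"
    and net: "\<And>u. L2_set u {..<n} = 1 \<Longrightarrow> \<exists>w\<in>N. L2_set (\<lambda>j. u j - w j) {..<n} \<le> \<epsilon>"
    and excess: "\<And>w. w \<in> N \<Longrightarrow> (\<Sum>i<m. max 0 ((row_dot n \<omega> w i)\<^sup>2 - K)) \<le> \<delta> * m"
    and few_small: "\<And>w. w \<in> N \<Longrightarrow> real (card {i. i < m \<and> \<bar>row_dot n \<omega> w i\<bar> < 2 * \<tau>}) \<le> m / 10"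
begin

text \<open>Each square is at most \<open>K\<close> plus its excess, and the total excess is bounded
  independently of \<open>T\<close>, so one event serves all sets \<open>T\<close>.\<close>

lemma sum_square_net_le:
  assumes "w \<in> N" "T \<subseteq> {..<m}"
  shows "(\<Sum>i\<in>T. (row_dot n \<omega> w i)\<^sup>2) \<le> card T * K + \<delta> * m"
proof -
  have "(\<Sum>i\<in>T. (row_dot n \<omega> w i)\<^sup>2) \<le> (\<Sum>i\<in>T. K + max 0 ((row_dot n \<omega> w i)\<^sup>2 - K))"
    by (intro sum_mono) auto
  also have "\<dots> = card T * K + (\<Sum>i\<in>T. max 0 ((row_dot n \<omega> w i)\<^sup>2 - K))"
    by (simp add: sum.distrib)
  also have "(\<Sum>i\<in>T. max 0 ((row_dot n \<omega> w i)\<^sup>2 - K)) \<le> (\<Sum>i<m. max 0 ((row_dot n \<omega> w i)\<^sup>2 - K))"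
    using assms(2) by (intro sum_mono2) auto
  also have "\<dots> \<le> \<delta> * m" by (rule excess[OF assms(1)])
  finally show ?thesis by simp
qed

text \<open>With \<open>T = {..<m}\<close> the previous bound controls the norm on the net, and
  \<open>operator_norm_le_net\<close> extends it to all vectors.\<close>

lemma sum_square_row_dot_le:
  "(\<Sum>i<m. (row_dot n \<omega> u i)\<^sup>2) \<le> 4 * ((K + \<delta>) * m) * (L2_set u {..<n})\<^sup>2"
proof -
  let ?M = "sqrt ((K + \<delta>) * m)"
  have "L2_set (row_dot n \<omega> w) {..<m} \<le> ?M" if "w \<in> N" for w
    using sum_square_net_le[OF that, of "{..<m}"] unfolding L2_set_def
    by (intro real_sqrt_le_mono) (simp add: algebra_simps)
  then have "L2_set (row_dot n \<omega> u) {..<m} \<le> 2 * ?M * L2_set u {..<n}"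
    using pos \<epsilon>_le net by (intro operator_norm_le_net) auto
  then have "(L2_set (row_dot n \<omega> u) {..<m})\<^sup>2 \<le> (2 * ?M * L2_set u {..<n})\<^sup>2"
    by (intro power_mono L2_set_nonneg)
  then show ?thesis using pos by (simp add: L2_set_power2 power_mult_distrib)
qed

text \<open>The operator norm bound is applied to \<open>u - w\<close>; the condition
  \<open>mesh\<close> is made for this.\<close>

lemma net_approximation:
  assumes "L2_set u {..<n} = 1"
  obtains w where "w \<in> N"
    "(\<Sum>i<m. (row_dot n \<omega> u i - row_dot n \<omega> w i)\<^sup>2) \<le> \<tau>\<^sup>2 / 32 * m"
proof -
  obtain w where w: "w \<in> N" "L2_set (\<lambda>j. u j - w j) {..<n} \<le> \<epsilon>" using net assms by blast
  have "(\<Sum>i<m. (row_dot n \<omega> u i - row_dot n \<omega> w i)\<^sup>2)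
      \<le> 4 * ((K + \<delta>) * m) * (L2_set (\<lambda>j. u j - w j) {..<n})\<^sup>2"
    using sum_square_row_dot_le[of "\<lambda>j. u j - w j"] by (simp add: row_dot_diff)
  also have "\<dots> \<le> 4 * ((K + \<delta>) * m) * \<epsilon>\<^sup>2"
    using w(2) pos by (intro mult_left_mono power_mono L2_set_nonneg) auto
  also have "\<dots> = (128 * \<epsilon>\<^sup>2 * (K + \<delta>)) / 32 * m" by simp
  also have "\<dots> \<le> \<tau>\<^sup>2 / 32 * m" using mesh by (intro mult_right_mono divide_right_mono) auto
  finally show thesis using that w(1) by blast
qed

text \<open>Passing to a nearby net point leaves three terms of at most
  \<open>\<tau>\<^sup>2 / 32 * m\<close>: from \<open>K\<close> on \<open>T\<close>, from the excess
  and from the approximation. Each is doubled, and \<open>6 / 32 \<le> 1 / 4\<close>.\<close>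

lemma sum_square_unit_le:
  assumes u: "L2_set u {..<n} = 1" and T: "T \<subseteq> {..<m}" "real (card T) \<le> s * m"
  shows "(\<Sum>i\<in>T. (row_dot n \<omega> u i)\<^sup>2) \<le> \<tau>\<^sup>2 / 4 * m"
proof -
  obtain w where w: "w \<in> N" "(\<Sum>i<m. (row_dot n \<omega> u i - row_dot n \<omega> w i)\<^sup>2) \<le> \<tau>\<^sup>2 / 32 * m"
    using net_approximation[OF u] .
  have "(\<Sum>i\<in>T. (row_dot n \<omega> u i)\<^sup>2) \<le>
      (\<Sum>i\<in>T. 2 * (row_dot n \<omega> w i)\<^sup>2 + 2 * (row_dot n \<omega> u i - row_dot n \<omega> w i)\<^sup>2)"
  proof (rule sum_mono)
    fix i
    show "(row_dot n \<omega> u i)\<^sup>2 \<le> 2 * (row_dot n \<omega> w i)\<^sup>2 + 2 * (row_dot n \<omega> u i - row_dot n \<omega> w i)\<^sup>2"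
      \<comment> \<open>The right side minus the left side is exactly this square.\<close>
      using zero_le_power2[of "row_dot n \<omega> u i - 2 * row_dot n \<omega> w i"]
      by (simp add: power2_eq_square algebra_simps)
  qed
  also have "\<dots> = 2 * (\<Sum>i\<in>T. (row_dot n \<omega> w i)\<^sup>2) + 2 * (\<Sum>i\<in>T. (row_dot n \<omega> u i - row_dot n \<omega> w i)\<^sup>2)"
    by (simp add: sum.distrib sum_distrib_left)
  also have "(\<Sum>i\<in>T. (row_dot n \<omega> u i - row_dot n \<omega> w i)\<^sup>2) \<le> (\<Sum>i<m. (row_dot n \<omega> u i - row_dot n \<omega> w i)\<^sup>2)"
    using T(1) by (intro sum_mono2) auto
  also have "\<dots> \<le> \<tau>\<^sup>2 / 32 * m" by (rule w)
  also have "(\<Sum>i\<in>T. (row_dot n \<omega> w i)\<^sup>2) \<le> card T * K + \<delta> * m" by (rule sum_square_net_le[OF w(1) T(1)])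
  also have "card T * K \<le> s * m * K" using T(2) pos by (intro mult_right_mono) auto
  also have "s * m * K = (32 * (s * K)) / 32 * m" by simp
  also have "\<dots> \<le> \<tau>\<^sup>2 / 32 * m" using s_le by (intro mult_right_mono divide_right_mono) auto
  also have "\<delta> * m = (32 * \<delta>) / 32 * m" by simp
  also have "\<dots> \<le> \<tau>\<^sup>2 / 32 * m" using \<delta>_le by (intro mult_right_mono divide_right_mono) auto
  finally have "(\<Sum>i\<in>T. (row_dot n \<omega> u i)\<^sup>2) \<le> 6 * (\<tau>\<^sup>2 / 32 * m)" by simp
  also have "\<dots> \<le> \<tau>\<^sup>2 / 4 * m" by simp
  finally show ?thesis .
qed

text \<open>A coordinate below \<open>\<tau>\<close> for \<open>u\<close> is below
  \<open>2 * \<tau>\<close> for the net point \<open>w\<close>, or the two values differ by at least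
  \<open>\<tau>\<close>. Comparing squares, the latter happens at most \<open>m / 32\<close> times,
  and \<open>1 / 10 + 1 / 32 \<le> 1 / 5\<close>.\<close>

lemma card_small_unit_le:
  assumes u: "L2_set u {..<n} = 1"
  shows "real (card {i. i < m \<and> \<bar>row_dot n \<omega> u i\<bar> < \<tau>}) \<le> m / 5"
proof -
  obtain w where w: "w \<in> N" "(\<Sum>i<m. (row_dot n \<omega> u i - row_dot n \<omega> w i)\<^sup>2) \<le> \<tau>\<^sup>2 / 32 * m"
    using net_approximation[OF u] .
  define X where "X = {i. i < m \<and> \<bar>row_dot n \<omega> w i\<bar> < 2 * \<tau>}"
  define Y where "Y = {i. i < m \<and> \<tau> \<le> \<bar>row_dot n \<omega> u i - row_dot n \<omega> w i\<bar>}"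
  have "card Y * \<tau>\<^sup>2 = (\<Sum>i\<in>Y. \<tau>\<^sup>2)" by simp
  also have "\<dots> \<le> (\<Sum>i\<in>Y. (row_dot n \<omega> u i - row_dot n \<omega> w i)\<^sup>2)"
    using pos by (intro sum_mono) (auto simp: Y_def abs_le_square_iff[symmetric])
  also have "\<dots> \<le> (\<Sum>i<m. (row_dot n \<omega> u i - row_dot n \<omega> w i)\<^sup>2)"
    by (intro sum_mono2) (auto simp: Y_def)
  also have "\<dots> \<le> m / 32 * \<tau>\<^sup>2" using w(2) by (simp add: mult.commute)
  finally have Y: "real (card Y) \<le> m / 32" using pos by (simp add: mult_le_cancel_right)
  have "card {i. i < m \<and> \<bar>row_dot n \<omega> u i\<bar> < \<tau>} \<le> card (X \<union> Y)"
    by (intro card_mono) (auto simp: X_def Y_def)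
  also have "\<dots> \<le> card X + card Y" by (rule card_Un_le)
  finally show ?thesis using Y few_small[OF w(1)] unfolding X_def by linarith
qed

text \<open>The AM-GM inequality bounds the sum over \<open>T\<close> by
  \<open>\<tau>\<^sup>2 / 4 * m\<close>, while the indices in \<open>G\<close> alone contribute at
  least \<open>\<tau>\<^sup>2 / 2 * m\<close> outside \<open>T\<close>.\<close>

lemma sum_product_unit_le:
  assumes u: "L2_set u {..<n} = 1" and v: "L2_set v {..<n} = 1"
    and T: "T \<subseteq> {..<m}" "real (card T) \<le> s * m"
  shows "(\<Sum>i\<in>T. \<bar>row_dot n \<omega> u i * row_dot n \<omega> v i\<bar>)
    \<le> 1 / 2 * (\<Sum>i\<in>{..<m} - T. \<bar>row_dot n \<omega> u i * row_dot n \<omega> v i\<bar>)"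
proof -
  let ?a = "row_dot n \<omega> u" and ?b = "row_dot n \<omega> v"
  have "(\<Sum>i\<in>T. \<bar>?a i * ?b i\<bar>) \<le> (\<Sum>i\<in>T. ((?a i)\<^sup>2 + (?b i)\<^sup>2) / 2)"
  proof (rule sum_mono)
    fix i
    show "\<bar>?a i * ?b i\<bar> \<le> ((?a i)\<^sup>2 + (?b i)\<^sup>2) / 2"
      using sum_squares_bound[of "\<bar>?a i\<bar>" "\<bar>?b i\<bar>"] by (simp add: abs_mult)
  qed
  also have "\<dots> = ((\<Sum>i\<in>T. (?a i)\<^sup>2) + (\<Sum>i\<in>T. (?b i)\<^sup>2)) / 2"
    by (simp add: sum.distrib sum_divide_distrib[symmetric])
  also have "\<dots> \<le> \<tau>\<^sup>2 / 4 * m"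
    using sum_square_unit_le[OF u T] sum_square_unit_le[OF v T] by simp
  finally have upper: "(\<Sum>i\<in>T. \<bar>?a i * ?b i\<bar>) \<le> \<tau>\<^sup>2 / 4 * m" .
  define X where "X = {i. i < m \<and> \<bar>?a i\<bar> < \<tau>}"
  define Y where "Y = {i. i < m \<and> \<bar>?b i\<bar> < \<tau>}"
  \<comment> \<open>Removing \<open>T\<close>, \<open>X\<close> and \<open>Y\<close> costs at most
    \<open>m / 10 + m / 5 + m / 5\<close> indices, so at least half of them stay in
    \<open>G\<close>.\<close>
  define G where "G = {..<m} - T - X - Y"
  have "finite T" using T(1) finite_subset by blast
  then have fin: "finite (G \<union> T \<union> X \<union> Y)" by (auto simp: G_def X_def Y_def)
  have "m = card {..<m}" by simp
  also have "\<dots> \<le> card (G \<union> T \<union> X \<union> Y)" by (rule card_mono[OF fin]) (auto simp: G_def)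
  also have "\<dots> \<le> card G + card T + card X + card Y"
    by (meson add_right_mono card_Un_le order_trans)
  finally have "real m \<le> card G + card T + card X + card Y" by linarith
  moreover have "s * m \<le> 1 / 10 * m" using s_le by (intro mult_right_mono) auto
  ultimately have G: "m / 2 \<le> real (card G)"
    using T(2) card_small_unit_le[OF u] card_small_unit_le[OF v] unfolding X_def Y_def by linarith
  have "\<tau>\<^sup>2 * (m / 2) \<le> \<tau>\<^sup>2 * card G" using G by (intro mult_left_mono) auto
  also have "\<dots> = (\<Sum>i\<in>G. \<tau> * \<tau>)" by (simp add: power2_eq_square)
  also have "\<dots> \<le> (\<Sum>i\<in>G. \<bar>?a i\<bar> * \<bar>?b i\<bar>)"
    using pos by (intro sum_mono mult_mono) (auto simp: G_def X_def Y_def)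
  also have "\<dots> = (\<Sum>i\<in>G. \<bar>?a i * ?b i\<bar>)" by (simp add: abs_mult)
  also have "\<dots> \<le> (\<Sum>i\<in>{..<m} - T. \<bar>?a i * ?b i\<bar>)" by (intro sum_mono2) (auto simp: G_def)
  finally show ?thesis using upper by simp
qed

text \<open>Both sides are homogeneous in \<open>u\<close> and in \<open>v\<close>, which reduces
  the claim to unit vectors.\<close>

lemma sum_product_le:
  assumes T: "T \<subseteq> {..<m}" "real (card T) \<le> s * m"
  shows "(\<Sum>i\<in>T. \<bar>row_dot n \<omega> u i * row_dot n \<omega> v i\<bar>)
    \<le> 1 / 2 * (\<Sum>i\<in>{..<m} - T. \<bar>row_dot n \<omega> u i * row_dot n \<omega> v i\<bar>)"
proof (cases "L2_set u {..<n} = 0 \<or> L2_set v {..<n} = 0")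
  case True
  then have zero: "row_dot n \<omega> u i * row_dot n \<omega> v i = 0" for i
    by (auto simp: L2_set_eq_0_iff row_dot_def)
  show ?thesis by (simp only: zero) simp
next
  case False
  let ?p = "L2_set u {..<n}" and ?q = "L2_set v {..<n}"
  let ?u = "\<lambda>j. (1 / ?p) * u j" and ?v = "\<lambda>j. (1 / ?q) * v j"
  have pos: "?p * ?q > 0" using False L2_set_nonneg[of u "{..<n}"] L2_set_nonneg[of v "{..<n}"]
    by (intro mult_pos_pos) linarith+
  have eq: "\<bar>row_dot n \<omega> u i * row_dot n \<omega> v i\<bar> = ?p * ?q * \<bar>row_dot n \<omega> ?u i * row_dot n \<omega> ?v i\<bar>" for i
    using False pos by (simp only: row_dot_scale) (simp add: abs_mult L2_set_nonneg)
  have "?p * ?q * (\<Sum>i\<in>T. \<bar>row_dot n \<omega> ?u i * row_dot n \<omega> ?v i\<bar>)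
      \<le> ?p * ?q * (1 / 2 * (\<Sum>i\<in>{..<m} - T. \<bar>row_dot n \<omega> ?u i * row_dot n \<omega> ?v i\<bar>))"
    using False pos by (intro mult_left_mono sum_product_unit_le T L2_set_normalize) auto
  then show ?thesis unfolding eq sum_distrib_left[symmetric] by simp
qed

end

section \<open>The high-probability event\<close>

text \<open>The range inequality in the variables \<open>u = x - y\<close> and
  \<open>v = x + y\<close>; the factor \<open>1 / 2\<close> becomes the \<open>\<psi>\<close> of the
  theorem.\<close>

definition products_spread :: "nat \<Rightarrow> nat \<Rightarrow> real \<Rightarrow> (nat \<times> nat \<Rightarrow> real) \<Rightarrow> bool" where
  "products_spread m n s \<omega> \<longleftrightarrow> (\<forall>u v. \<forall>T\<subseteq>{..<m}. real (card T) \<le> s * real m \<longrightarrow>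
     (\<Sum>i\<in>T. \<bar>row_dot n \<omega> u i * row_dot n \<omega> v i\<bar>)
     \<le> 1 / 2 * (\<Sum>i\<in>{..<m} - T. \<bar>row_dot n \<omega> u i * row_dot n \<omega> v i\<bar>))"

section \<open>Measurability of the event\<close>

lemma rational_approximation_sequence:
  "\<exists>f :: nat \<Rightarrow> real \<Rightarrow> rat. \<forall>x. (\<lambda>k. real_of_rat (f k x)) \<longlonglongrightarrow> x"
proof -
  define f where "f k x = (SOME q. x < real_of_rat q \<and> real_of_rat q < x + 1 / real (Suc k))" for k x
  have f: "x < real_of_rat (f k x) \<and> real_of_rat (f k x) < x + 1 / real (Suc k)" for k x
    unfolding f_def by (rule someI_ex, rule of_rat_dense) simp
  have "(\<lambda>k. real_of_rat (f k x)) \<longlonglongrightarrow> x" for x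
  proof (rule tendsto_sandwich[of "\<lambda>_. x" _ _ "\<lambda>k. x + 1 / real (Suc k)"])
    show "(\<lambda>k. x + 1 / real (Suc k)) \<longlonglongrightarrow> x"
      using tendsto_add[OF tendsto_const LIMSEQ_Suc[OF lim_1_over_n]] by simp
  qed (auto intro!: always_eventually less_imp_le simp: f simp del: of_nat_Suc)
  then show ?thesis by blast
qed

text \<open>A non-measurable event would get the junk measure 0; by continuity in \<open>u\<close> and \<open>v\<close> the
  event is a countable intersection.\<close>

lemma products_spread_iff_rational:
  "products_spread m n s \<omega> \<longleftrightarrow> (\<forall>p q :: rat list. \<forall>T\<in>Pow {..<m}. real (card T) \<le> s * real m \<longrightarrow>
     (\<Sum>i\<in>T. \<bar>row_dot n \<omega> (\<lambda>j. real_of_rat (p ! j)) i * row_dot n \<omega> (\<lambda>j. real_of_rat (q ! j)) i\<bar>)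
     \<le> 1 / 2 * (\<Sum>i\<in>{..<m} - T.
         \<bar>row_dot n \<omega> (\<lambda>j. real_of_rat (p ! j)) i * row_dot n \<omega> (\<lambda>j. real_of_rat (q ! j)) i\<bar>))"
    (is "_ \<longleftrightarrow> ?R")
proof
  assume R: ?R
  show "products_spread m n s \<omega>"
    unfolding products_spread_def
  proof (intro allI impI)
    fix u v :: "nat \<Rightarrow> real" and T assume T: "T \<subseteq> {..<m}" "real (card T) \<le> s * m"
    obtain f :: "nat \<Rightarrow> real \<Rightarrow> rat" where f: "\<And>x. (\<lambda>k. real_of_rat (f k x)) \<longlonglongrightarrow> x"
      using rational_approximation_sequence by blast
    \<comment> \<open>Lists of rationals form a countable type, unlike functions from the naturals
      to the rationals; \<open>row_dot\<close> reads only the first \<open>n\<close>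
      entries.\<close>
    define g where "g k u = map (\<lambda>j. f k (u j)) [0..<n]" for k u
    have [tendsto_intros]: "(\<lambda>k. row_dot n \<omega> (\<lambda>j. real_of_rat (g k u ! j)) i) \<longlonglongrightarrow> row_dot n \<omega> u i" for u i
    proof -
      have "(\<lambda>k. \<Sum>j<n. \<omega> (i, j) * real_of_rat (f k (u j))) \<longlonglongrightarrow> (\<Sum>j<n. \<omega> (i, j) * u j)"
        by (intro tendsto_intros f)
      then show ?thesis by (simp add: row_dot_def g_def)
    qed
    show "(\<Sum>i\<in>T. \<bar>row_dot n \<omega> u i * row_dot n \<omega> v i\<bar>)
        \<le> 1 / 2 * (\<Sum>i\<in>{..<m} - T. \<bar>row_dot n \<omega> u i * row_dot n \<omega> v i\<bar>)"
    proof (rule LIMSEQ_le)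
      show "(\<lambda>k. \<Sum>i\<in>T. \<bar>row_dot n \<omega> (\<lambda>j. real_of_rat (g k u ! j)) i * row_dot n \<omega> (\<lambda>j. real_of_rat (g k v ! j)) i\<bar>)
          \<longlonglongrightarrow> (\<Sum>i\<in>T. \<bar>row_dot n \<omega> u i * row_dot n \<omega> v i\<bar>)"
        by (intro tendsto_intros)
      show "(\<lambda>k. 1 / 2 * (\<Sum>i\<in>{..<m} - T. \<bar>row_dot n \<omega> (\<lambda>j. real_of_rat (g k u ! j)) i * row_dot n \<omega> (\<lambda>j. real_of_rat (g k v ! j)) i\<bar>))
          \<longlonglongrightarrow> 1 / 2 * (\<Sum>i\<in>{..<m} - T. \<bar>row_dot n \<omega> u i * row_dot n \<omega> v i\<bar>)"
        by (intro tendsto_intros)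
    qed (use R T in blast)
  qed
next
  assume "products_spread m n s \<omega>"
  from this[unfolded products_spread_def, rule_format]
  show ?R by (intro allI ballI impI) (simp only: Pow_iff)
qed

lemma measurable_products_spread:
  "Measurable.pred (gaussian_entries m n) (products_spread m n s)"
proof -
  have meas: "(\<lambda>\<omega>. \<Sum>i\<in>T. \<bar>row_dot n \<omega> u i * row_dot n \<omega> v i\<bar>) \<in> borel_measurable (gaussian_entries m n)"
    if "T \<subseteq> {..<m}" for T u v
    using that by (intro borel_measurable_sum borel_measurable_abs borel_measurable_times measurable_row_dot) auto
  show ?thesis
    unfolding products_spread_iff_rational
  proof (intro pred_intros_countable(1) pred_intros_finite(3) pred_intros_imp')
    fix p q :: "rat list" and T assume "T \<in> Pow {..<m}"
    then have T: "T \<subseteq> {..<m}" "{..<m} - T \<subseteq> {..<m}" by auto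
    show "Measurable.pred (gaussian_entries m n) (\<lambda>\<omega>.
      (\<Sum>i\<in>T. \<bar>row_dot n \<omega> (\<lambda>j. real_of_rat (p ! j)) i * row_dot n \<omega> (\<lambda>j. real_of_rat (q ! j)) i\<bar>)
      \<le> 1 / 2 * (\<Sum>i\<in>{..<m} - T.
          \<bar>row_dot n \<omega> (\<lambda>j. real_of_rat (p ! j)) i * row_dot n \<omega> (\<lambda>j. real_of_rat (q ! j)) i\<bar>))"
      unfolding pred_def
      by (intro borel_measurable_le borel_measurable_times borel_measurable_const meas T)
  qed simp
qed

section \<open>Translation between vectors of squares and products\<close>

lemma l1_norm_vec_on_abs_square_diff:
  assumes "T \<subseteq> {..<m}"
  shows "l1_norm_vec (vec_on (abs_pow_vec 2 (mat m n \<omega> *\<^sub>v vec n a) - abs_pow_vec 2 (mat m n \<omega> *\<^sub>v vec n b)) T)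
    = (\<Sum>i\<in>T. \<bar>row_dot n \<omega> (\<lambda>j. a j - b j) i * row_dot n \<omega> (\<lambda>j. a j + b j) i\<bar>)"
proof -
  have mv: "vec_index (mat m n \<omega> *\<^sub>v vec n c) i = row_dot n \<omega> c i" if "i < m" for c i
    using that by (simp add: scalar_prod_def row_dot_def atLeast0LessThan)
  have sq: "\<bar>row_dot n \<omega> a i\<bar>\<^sup>2 - \<bar>row_dot n \<omega> b i\<bar>\<^sup>2 =
      row_dot n \<omega> (\<lambda>j. a j - b j) i * row_dot n \<omega> (\<lambda>j. a j + b j) i" for i
    by (simp add: row_dot_def sum.distrib sum_subtractf algebra_simps power2_eq_square)
  let ?z = "abs_pow_vec 2 (mat m n \<omega> *\<^sub>v vec n a) - abs_pow_vec 2 (mat m n \<omega> *\<^sub>v vec n b)"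
  have "dim_vec ?z = m" by (simp add: abs_pow_vec_def)
  then have "l1_norm_vec (vec_on ?z T) = (\<Sum>i<m. \<bar>if i \<in> T then vec_index ?z i else 0\<bar>)"
    by (simp add: l1_norm_vec_def vec_on_def)
  also have "\<dots> = (\<Sum>i\<in>T. \<bar>vec_index ?z i\<bar>)"
    using assms by (intro sum.mono_neutral_cong_right) auto
  also have "\<dots> = (\<Sum>i\<in>T. \<bar>row_dot n \<omega> (\<lambda>j. a j - b j) i * row_dot n \<omega> (\<lambda>j. a j + b j) i\<bar>)"
  proof (rule sum.cong)
    fix i assume "i \<in> T"
    then have "i < m" using assms by auto
    then show "\<bar>vec_index ?z i\<bar> = \<bar>row_dot n \<omega> (\<lambda>j. a j - b j) i * row_dot n \<omega> (\<lambda>j. a j + b j) i\<bar>"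
      using mv[OF \<open>i < m\<close>]
      by (simp add: abs_pow_vec_def sq[symmetric] del: index_mult_mat_vec power2_abs)
  qed simp
  finally show ?thesis .
qed

text \<open>The map \<open>(x, y) \<mapsto> (x - y, x + y)\<close> is a bijection, so both sides quantify over the same data.\<close>

lemma abs_square_range_iff_products_spread:
  "(\<forall>x\<in>carrier_vec n. \<forall>y\<in>carrier_vec n. \<forall>T\<subseteq>{..<m}. real (card T) \<le> s * real m \<longrightarrow>
      l1_norm_vec (vec_on (abs_pow_vec 2 (mat m n \<omega> *\<^sub>v x) - abs_pow_vec 2 (mat m n \<omega> *\<^sub>v y)) T)
      \<le> 1 / 2 * l1_norm_vec (vec_on (abs_pow_vec 2 (mat m n \<omega> *\<^sub>v x) - abs_pow_vec 2 (mat m n \<omega> *\<^sub>v y))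
                             ({..<m} - T)))
   \<longleftrightarrow> products_spread m n s \<omega>" (is "?L \<longleftrightarrow> _")
proof
  assume L: ?L
  show "products_spread m n s \<omega>"
    unfolding products_spread_def
  proof (intro allI impI)
    fix u v :: "nat \<Rightarrow> real" and T assume T: "T \<subseteq> {..<m}" "real (card T) \<le> s * m"
    let ?a = "\<lambda>j. (v j + u j) / 2" and ?b = "\<lambda>j. (v j - u j) / 2"
    have "(\<lambda>j. ?a j - ?b j) = u" "(\<lambda>j. ?a j + ?b j) = v" by (auto simp: field_simps)
    then show "(\<Sum>i\<in>T. \<bar>row_dot n \<omega> u i * row_dot n \<omega> v i\<bar>)
        \<le> 1 / 2 * (\<Sum>i\<in>{..<m} - T. \<bar>row_dot n \<omega> u i * row_dot n \<omega> v i\<bar>)"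
      using L[rule_format, OF vec_carrier vec_carrier T, of ?a ?b]
        l1_norm_vec_on_abs_square_diff[OF T(1), of n \<omega> ?a ?b]
        l1_norm_vec_on_abs_square_diff[of "{..<m} - T" m n \<omega> ?a ?b] by simp
  qed
next
  assume P: "products_spread m n s \<omega>"
  show ?L
  proof (intro ballI allI impI)
    fix x y :: "real vec" and T
    assume xy: "x \<in> carrier_vec n" "y \<in> carrier_vec n" and T: "T \<subseteq> {..<m}" "real (card T) \<le> s * m"
    let ?u = "\<lambda>j. vec_index x j - vec_index y j" and ?v = "\<lambda>j. vec_index x j + vec_index y j"
    have vec: "vec n (vec_index x) = x" "vec n (vec_index y) = y" using xy by auto
    have "(\<Sum>i\<in>T. \<bar>row_dot n \<omega> ?u i * row_dot n \<omega> ?v i\<bar>)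
        \<le> 1 / 2 * (\<Sum>i\<in>{..<m} - T. \<bar>row_dot n \<omega> ?u i * row_dot n \<omega> ?v i\<bar>)"
      using P T unfolding products_spread_def by blast
    then show "l1_norm_vec (vec_on (abs_pow_vec 2 (mat m n \<omega> *\<^sub>v x) - abs_pow_vec 2 (mat m n \<omega> *\<^sub>v y)) T)
      \<le> 1 / 2 * l1_norm_vec (vec_on (abs_pow_vec 2 (mat m n \<omega> *\<^sub>v x) - abs_pow_vec 2 (mat m n \<omega> *\<^sub>v y))
                             ({..<m} - T))"
      using l1_norm_vec_on_abs_square_diff[OF T(1), of n \<omega> "vec_index x" "vec_index y"]
        l1_norm_vec_on_abs_square_diff[of "{..<m} - T" m n \<omega> "vec_index x" "vec_index y"]
      by (simp add: vec)
  qed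
qed

text \<open>A union bound over the net and over the two ways \<open>E w\<close> and
  \<open>H w\<close> in which a net point can fail. Outside all of them the assumptions of
  \<open>spread_on_net\<close> hold.\<close>

lemma prob_products_spread_ge_net:
  fixes m n :: nat and \<epsilon> K \<delta> \<tau> s :: real and N :: "(nat \<Rightarrow> real) set"
  defines "M \<equiv> gaussian_entries m n"
  assumes pos: "0 < \<epsilon>" "0 < K" "0 < \<delta>" "0 < \<tau>"
    and \<epsilon>_le: "\<epsilon> \<le> 1 / 2" and mesh: "128 * \<epsilon>\<^sup>2 * (K + \<delta>) \<le> \<tau>\<^sup>2"
    and \<delta>_le: "32 * \<delta> \<le> \<tau>\<^sup>2" "\<delta> \<le> 8" and s_le: "s \<le> 1 / 10" "32 * (s * K) \<le> \<tau>\<^sup>2"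
    and small_ball: "4 * \<tau> * exp 20 \<le> 1" and tail: "2 * exp (- K / 4) \<le> \<delta> / 8"
    and N: "finite N" "\<And>w. w \<in> N \<Longrightarrow> L2_set w {..<n} = 1"
      "\<And>u. L2_set u {..<n} = 1 \<Longrightarrow> \<exists>w\<in>N. L2_set (\<lambda>j. u j - w j) {..<n} \<le> \<epsilon>"
  shows "measure M {\<omega> \<in> space M. products_spread m n s \<omega>} \<ge> 1 - 2 * card N * exp (- (\<delta> / 8) * m)"
proof -
  interpret prob_space M unfolding M_def by (rule prob_space_gaussian_entries)
  have [measurable]: "Measurable.pred M (products_spread m n s)"
    unfolding M_def by (rule measurable_products_spread)
  \<comment> \<open>Both functions include the exponential parameter. With weight 20, a sum below
    \<open>2 * m\<close> leaves at most \<open>m / 10\<close> small coordinates; the factor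
    \<open>1 / 4\<close> is the one for which the Gaussian expectation of
    \<open>exp (x\<^sup>2 / 4)\<close> was computed.\<close>
  let ?F = "\<lambda>x. if \<bar>x\<bar> < 2 * \<tau> then 20 else 0 :: real" and ?G = "\<lambda>x :: real. max 0 (x\<^sup>2 - K) / 4"
  define E where "E w = {\<omega> \<in> space M. (\<Sum>i<m. ?F (row_dot n \<omega> w i)) \<ge> 2 * real m}" for w
  define H where "H w = {\<omega> \<in> space M. (\<Sum>i<m. ?G (row_dot n \<omega> w i)) \<ge> \<delta> / 4 * m}" for w
  have [measurable]: "E w \<in> events" "H w \<in> events" for w
  proof -
    have [measurable]: "(\<lambda>\<omega>. row_dot n \<omega> w i) \<in> borel_measurable M" if "i < m" for i
      unfolding M_def by (rule measurable_row_dot[OF that])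
    show "E w \<in> events" unfolding E_def by measurable
    show "H w \<in> events" unfolding H_def by measurable
  qed
  have E: "prob (E w) \<le> exp (- (\<delta> / 8) * m)" if "w \<in> N" for w
  proof -
    have "prob (E w) \<le> exp (- (2 - 2 * (2 * \<tau>) * exp 20) * m)"
      unfolding E_def M_def using pos
      by (intro prob_sum_row_dot_ge N that std_normal_mgf_indicator_le) auto
    \<comment> \<open>By \<open>small_ball\<close> the loss \<open>4 * \<tau> * exp 20\<close> is at
      most 1, so the rate is at least 1, and \<open>\<delta> \<le> 8\<close> allows the common rate
      \<open>\<delta> / 8\<close>.\<close>
    also have "\<dots> \<le> exp (- (\<delta> / 8) * m)"
      using small_ball \<delta>_le by (subst exp_le_cancel_iff, intro mult_right_mono) auto
    finally show ?thesis .
  qed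
  have H: "prob (H w) \<le> exp (- (\<delta> / 8) * m)" if "w \<in> N" for w
  proof -
    have "prob (H w) \<le> exp (- (\<delta> / 4 - 2 * exp (- K / 4)) * m)"
      unfolding H_def M_def
      by (intro prob_sum_row_dot_ge N that std_normal_mgf_excess_le) auto
    \<comment> \<open>By \<open>tail\<close> the loss is at most half of the rate
      \<open>\<delta> / 4\<close>.\<close>
    also have "\<dots> \<le> exp (- (\<delta> / 8) * m)"
      using tail by (subst exp_le_cancel_iff, intro mult_right_mono) auto
    finally show ?thesis .
  qed
  have "space M - (\<Union>w\<in>N. E w \<union> H w) \<subseteq> {\<omega> \<in> space M. products_spread m n s \<omega>}"
  proof safe
    fix \<omega> assume \<omega>: "\<omega> \<in> space M" "\<omega> \<notin> (\<Union>w\<in>N. E w \<union> H w)"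
    interpret spread_on_net m n \<omega> N \<epsilon> K \<delta> \<tau> s
    proof unfold_locales
      fix w assume w: "w \<in> N"
      have "(\<Sum>i<m. ?G (row_dot n \<omega> w i)) < \<delta> / 4 * m"
        using \<omega> w by (auto simp: H_def not_le)
      then show "(\<Sum>i<m. max 0 ((row_dot n \<omega> w i)\<^sup>2 - K)) \<le> \<delta> * m"
        by (simp add: sum_divide_distrib[symmetric])
      have "(\<Sum>i<m. ?F (row_dot n \<omega> w i)) < 2 * real m"
        using \<omega> w by (auto simp: E_def not_le)
      also have "(\<Sum>i<m. ?F (row_dot n \<omega> w i)) = (\<Sum>i\<in>{i. i < m \<and> \<bar>row_dot n \<omega> w i\<bar> < 2 * \<tau>}. 20)"
        by (intro sum.mono_neutral_cong_right) auto
      finally show "real (card {i. i < m \<and> \<bar>row_dot n \<omega> w i\<bar> < 2 * \<tau>}) \<le> m / 10"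
        by simp
    qed (fact pos \<epsilon>_le mesh \<delta>_le s_le N(3))+
    show "products_spread m n s \<omega>" unfolding products_spread_def using sum_product_le by blast
  qed
  then have "prob (space M - (\<Union>w\<in>N. E w \<union> H w)) \<le> prob {\<omega> \<in> space M. products_spread m n s \<omega>}"
    by (intro finite_measure_mono) auto
  moreover have "prob (space M - (\<Union>w\<in>N. E w \<union> H w)) = 1 - prob (\<Union>w\<in>N. E w \<union> H w)"
    using N(1) by (intro prob_compl) auto
  moreover have "prob (\<Union>w\<in>N. E w \<union> H w) \<le> (\<Sum>w\<in>N. prob (E w \<union> H w))"
    using N(1) by (intro finite_measure_subadditive_finite) auto
  moreover have "(\<Sum>w\<in>N. prob (E w \<union> H w)) \<le> (\<Sum>w\<in>N. 2 * exp (- (\<delta> / 8) * m))"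
  proof (rule sum_mono)
    fix w assume "w \<in> N"
    have "prob (E w \<union> H w) \<le> prob (E w) + prob (H w)"
      by (intro measure_Un_le) auto
    then show "prob (E w \<union> H w) \<le> 2 * exp (- (\<delta> / 8) * m)"
      using E[OF \<open>w \<in> N\<close>] H[OF \<open>w \<in> N\<close>] by linarith
  qed
  ultimately show ?thesis by simp
qed

text \<open>The net has at most \<open>D ^ n\<close> points, and \<open>m > c0 * n\<close> makes
  this at most \<open>exp (\<delta> / 16 * m)\<close>. Half of the rate \<open>\<delta> / 8\<close>
  pays for the net and the other half is \<open>c1\<close>.\<close>

lemma prob_products_spread_ge:
  obtains c0 c1 s :: real where "0 < c0" "0 < c1" "0 < s" "s < 1"
    "\<And>m n. real m > c0 * real n \<Longrightarrow>
      \<P>(\<omega> in gaussian_entries m n. products_spread m n s \<omega>) \<ge> 1 - 2 * exp (- c1 * real m)"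
proof -
  \<comment> \<open>Each constant is chosen from the earlier ones, none from \<open>m\<close> or
    \<open>n\<close>. \<open>\<tau>\<close>, \<open>\<delta>\<close> and \<open>K\<close> make the
    small ball condition, \<open>32 * \<delta> \<le> \<tau>\<^sup>2\<close> and the tail condition
    equalities; \<open>\<epsilon>\<close> and \<open>s\<close> are capped by the mesh and truncation
    conditions; the mesh then fixes \<open>D\<close> and \<open>c0\<close>.\<close>
  define \<tau> :: real where "\<tau> = exp (- 20) / 4"
  define \<delta> where "\<delta> = \<tau>\<^sup>2 / 32"
  define K where "K = 4 * ln (16 / \<delta>)"
  define \<epsilon> where "\<epsilon> = min (1 / 2) (\<tau> / sqrt (128 * (K + \<delta>)))"
  define s where "s = min (1 / 10) (\<tau>\<^sup>2 / (32 * K))"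
  define D where "D = 3 * exp (4 / \<epsilon>\<^sup>2)"
  define c0 where "c0 = 16 * ln D / \<delta>"
  have \<tau>: "0 < \<tau>" "\<tau> \<le> 1" by (auto simp: \<tau>_def intro: order_trans[of _ 1])
  then have \<delta>: "0 < \<delta>" "\<delta> \<le> 1"
    using power_le_one[of \<tau> 2] by (auto simp: \<delta>_def)
  have small: "32 * \<delta> \<le> \<tau>\<^sup>2" "4 * \<tau> * exp 20 \<le> 1" by (auto simp: \<delta>_def \<tau>_def exp_minus)
  have K: "0 < K" unfolding K_def using \<delta> by (simp add: field_simps)
  have tail: "2 * exp (- K / 4) = \<delta> / 8" using \<delta> by (simp add: K_def exp_minus)
  have \<epsilon>: "0 < \<epsilon>" "\<epsilon> \<le> 1 / 2"
    unfolding \<epsilon>_def using \<tau> \<delta> K by (simp_all only: min.cobounded1) simp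
  have "\<epsilon>\<^sup>2 \<le> (\<tau> / sqrt (128 * (K + \<delta>)))\<^sup>2" using \<epsilon> by (intro power_mono) (auto simp: \<epsilon>_def)
  then have mesh: "128 * \<epsilon>\<^sup>2 * (K + \<delta>) \<le> \<tau>\<^sup>2" using K \<delta> by (simp add: power_divide field_simps)
  have s: "0 < s" "s < 1" "s \<le> 1 / 10" using \<tau> K by (auto simp: s_def)
  have "s * K \<le> \<tau>\<^sup>2 / (32 * K) * K" using K by (intro mult_right_mono) (auto simp: s_def)
  then have sK: "32 * (s * K) \<le> \<tau>\<^sup>2" using K by simp
  have "1 < D" using \<epsilon> by (simp add: D_def less_le_trans[of 1 3])
  then have lnD: "0 < ln D" by simp
  then have c0: "0 < c0" using \<delta> by (simp add: c0_def)
  have bound: "\<P>(\<omega> in gaussian_entries m n. products_spread m n s \<omega>) \<ge> 1 - 2 * exp (- (\<delta> / 16) * m)"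
    if m: "real m > c0 * real n" for m n
  proof -
    obtain N :: "(nat \<Rightarrow> real) set" where N: "finite N" "real (card N) \<le> D ^ n"
      "\<And>w. w \<in> N \<Longrightarrow> L2_set w {..<n} = 1"
      "\<And>u. L2_set u {..<n} = 1 \<Longrightarrow> \<exists>w\<in>N. L2_set (\<lambda>j. u j - w j) {..<n} \<le> \<epsilon>"
      using sphere_net_exists[of \<epsilon> n] \<epsilon> unfolding D_def by auto
    have "1 - 2 * card N * exp (- (\<delta> / 8) * m) \<le> \<P>(\<omega> in gaussian_entries m n. products_spread m n s \<omega>)"
      using \<tau> \<delta> K \<epsilon> mesh s sK tail small N
      by (intro prob_products_spread_ge_net[where \<epsilon> = \<epsilon> and K = K and \<tau> = \<tau>])
         auto
    moreover have "card N * exp (- (\<delta> / 8) * m) \<le> exp (- (\<delta> / 16) * m)"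
    proof -
      have "real (card N) \<le> exp (n * ln D)" using N(2) \<open>1 < D\<close> by (simp add: exp_of_nat_mult)
      also have "n * ln D \<le> \<delta> / 16 * m"
        using m \<delta> by (simp add: c0_def field_simps)
      finally have "real (card N) * exp (- (\<delta> / 8) * m) \<le> exp (\<delta> / 16 * m) * exp (- (\<delta> / 8) * m)"
        by (intro mult_right_mono) auto
      then show ?thesis by (simp add: exp_add[symmetric] algebra_simps)
    qed
    ultimately show ?thesis by linarith
  qed
  show thesis using that[OF c0 _ s(1,2) bound] \<delta> by simp
qed

theorem lemma4p2:
  shows "\<exists>c0 c1 C s \<psi> :: real.
    0 < c0 \<and> 0 < c1 \<and> 0 < C \<and> 0 < s \<and> s < 1 \<and> 0 < \<psi> \<and> \<psi> < 1 \<and>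
    (\<forall>m n :: nat. real m > c0 * real n \<longrightarrow>
      \<P>(\<omega> in gaussian_entries m n.
        \<forall>x\<in>carrier_vec n. \<forall>y\<in>carrier_vec n. \<forall>T\<subseteq>{..<m}. real (card T) \<le> s * real m \<longrightarrow>
          l1_norm_vec (vec_on (abs_pow_vec 2 (mat m n \<omega> *\<^sub>v x) - abs_pow_vec 2 (mat m n \<omega> *\<^sub>v y)) T)
          \<le> \<psi> * l1_norm_vec (vec_on (abs_pow_vec 2 (mat m n \<omega> *\<^sub>v x) - abs_pow_vec 2 (mat m n \<omega> *\<^sub>v y))
                                 ({..<m} - T)))
      \<ge> 1 - C * exp (- c1 * real m)) \<and>
    (\<forall>\<epsilon>>0. \<exists>m0 :: nat. \<forall>m\<ge>m0. \<forall>n :: nat. real m > c0 * real n \<longrightarrow>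
      \<P>(\<omega> in gaussian_entries m n. absolute_range_property 2 (s * real m) \<psi> (mat m n \<omega>)) \<ge> 1 - \<epsilon>)"
proof -
  obtain c0 c1 s :: real where c: "0 < c0" "0 < c1" "0 < s" "s < 1" and prob:
    "\<And>m n. real m > c0 * real n \<Longrightarrow>
      \<P>(\<omega> in gaussian_entries m n. products_spread m n s \<omega>) \<ge> 1 - 2 * exp (- c1 * real m)"
    by (rule prob_products_spread_ge) blast
  \<comment> \<open>For \<open>\<psi> = 1 / 2\<close> the absolute range property is the same event,
    so the second claim only needs the failure bound to tend to 0.\<close>
  have arp: "absolute_range_property 2 (s * real m) (1 / 2) (mat m n \<omega>) \<longleftrightarrow> products_spread m n s \<omega>" for m n \<omega>
    using abs_square_range_iff_products_spread[of n m s \<omega>]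
    by (simp add: absolute_range_property_def)
  have high: "\<exists>m0 :: nat. \<forall>m\<ge>m0. \<forall>n. real m > c0 * real n \<longrightarrow>
      \<P>(\<omega> in gaussian_entries m n. products_spread m n s \<omega>) \<ge> 1 - \<epsilon>" if "\<epsilon> > 0" for \<epsilon>
  proof -
    \<comment> \<open>The failure bound does not involve \<open>n\<close>, so one \<open>m0\<close>
      serves all \<open>n\<close>.\<close>
    have "((\<lambda>m. 2 * exp (- c1 * real m)) \<longlongrightarrow> 0) sequentially"
      using c by real_asymp
    then have "eventually (\<lambda>m. 2 * exp (- c1 * real m) < \<epsilon>) sequentially"
      using \<open>\<epsilon> > 0\<close> by (rule order_tendstoD)
    then obtain m0 where m0: "\<And>m. m \<ge> m0 \<Longrightarrow> 2 * exp (- c1 * real m) < \<epsilon>"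
      by (auto simp: eventually_sequentially)
    have "\<P>(\<omega> in gaussian_entries m n. products_spread m n s \<omega>) \<ge> 1 - \<epsilon>"
      if "m \<ge> m0" "real m > c0 * real n" for m n
      using prob[OF that(2)] m0[OF that(1)] by linarith
    then show ?thesis by blast
  qed
  show ?thesis
  \<comment> \<open>\<open>C = 2\<close> counts the two failure events per net point, and
    \<open>\<psi> = 1 / 2\<close> is the ratio of the bounds \<open>\<tau>\<^sup>2 / 4 * m\<close>
    on \<open>T\<close> and \<open>\<tau>\<^sup>2 / 2 * m\<close> off \<open>T\<close>.\<close>
  proof (rule exI[of _ c0], rule exI[of _ c1], rule exI[of _ 2], rule exI[of _ s], rule exI[of _ "1 / 2"],
      intro conjI allI impI)
  qed (unfold abs_square_range_iff_products_spread arp, (rule c prob high | simp)+)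
qed

end
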